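(* Let $n\ge1$ and let $k$ be a non-negative integer. Let $X_1,\ldots,X_n$ be i.i.d. standard exponential random variables. Then for all non-negative real numbers $a_1,\ldots,a_n$ with $\sum_{i=1}^n a_i^2=1$, $$\mathbb{E}\left(a_1X_1+\cdots+a_nX_n\right)^k\ \ge\ \min\{\rho(1,k),\ldots,\rho(n,k)\}.$$ Moreover, the maximum of $\mathbb{E}(a_1X_1+\cdots+a_nX_n)^k$ over all non-negative $a_1,\ldots,a_n$ with $\sum_{i=1}^n a_i^2=1$ occurs at a unit vector with nonzero coordinates, $n-1$ of which are equal, that is, of the form $$(a_1,\ldots,a_n)=(s,\underbrace{t,\ldots,t}_{n-1\ \text{times}}),\qquad 0<t\le s,$$ where (for $n\ge 2$ and $k\ge1$) the ratio $x=t/s\in(0,1]$ is a root of the polynomial $$\begin{aligned}g(x)={}&\binom k1\Gamma(n)\Gamma(k)+\sum_{j=0}^{k-2}x^{j+1}\bigg[\binom kj\Gamma(j+n-1)\Gamma(k-j+1)(n-1)(j-k)\\&\qquad+(j+2)\binom k{j+2}\Gamma(j+n+1)\Gamma(k-j-1)\bigg]-\binom k{k-1}\Gamma(k+n-2)\Gamma(2)(n-1)x^k.\end{aligned}$$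
   Context: A standard exponential random variable has density $e^{-x}\mathbf 1_{x>0}$. For $m\in\mathbb{N}$ and real $q$, $\rho(m,q):=\mathbb{E}\left(\frac{X_1+\cdots+X_m}{\sqrt m}\right)^q$, where $X_1,\ldots,X_m$ are i.i.d. standard exponential random variables. $\Gamma$ is the Euler gamma function. *)

theory Defs
  imports "HOL-Probability.Probability"
begin

definition std_exponential :: "real measure" where
  "std_exponential = density lborel (\<lambda>x. ennreal (exponential_density 1 x))"

text \<open>The moment of order \<open>q\<close> of the normalized sum of \<open>m\<close> i.i.d. standard exponentials, realized as
  the coordinates of a product space.  The real power is harmless, as the sum is almost surely
  positive.  For \<open>q \<le> - m\<close> the expectation is infinite and the integral below is 0 by convention.\<close>

definition rho :: "nat \<Rightarrow> real \<Rightarrow> real" where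
  "rho m q = (\<integral>x. ((\<Sum>i=1..m. x i) / sqrt (real m)) powr q
                  \<partial>(\<Pi>\<^sub>M i\<in>{1..m}. std_exponential))"

text \<open>Only the coordinates with indices \<open>1, \<dots>, n\<close> of a function matter.\<close>

definition nonneg_unit_vectors :: "nat \<Rightarrow> (nat \<Rightarrow> real) set" where
  "nonneg_unit_vectors n = {a. (\<forall>i\<in>{1..n}. 0 \<le> a i) \<and> (\<Sum>i=1..n. (a i)\<^sup>2) = 1}"

text \<open>The index \<open>j\<close> ranges over \<open>0, \<dots>, k - 2\<close>; for \<open>k = 1\<close> the sum is empty.\<close>

definition g :: "nat \<Rightarrow> nat \<Rightarrow> real \<Rightarrow> real" where
  "g n k x =
     real (k choose 1) * Gamma (real n) * Gamma (real k)
     + (\<Sum>j<k - 1. x ^ (j + 1) *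
          (real (k choose j) * Gamma (real j + real n - 1) * Gamma (real k - real j + 1)
             * (real n - 1) * (real j - real k)
           + (real j + 2) * real (k choose (j + 2)) * Gamma (real j + real n + 1)
             * Gamma (real k - real j - 1)))
     - real (k choose (k - 1)) * Gamma (real k + real n - 2) * Gamma 2 * (real n - 1) * x ^ k"

end

theory Submission
  imports Defs
begin

text \<open>
  Expanding the power and using independence together with \<open>\<E> X\<^sub>i\<^sup>j = j!\<close>, the moment
  \<open>\<E> (a\<^sub>1 X\<^sub>1 + \<dots> + a\<^sub>n X\<^sub>n)\<^sup>k\<close> becomes \<open>k!\<close> times the complete homogeneous symmetric
  polynomial \<open>h\<^sub>k(a\<^sub>1, \<dots>, a\<^sub>n)\<close>; this is \<open>moment_exponential_combination\<close>.  What remains is to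
  locate the extremal points of \<open>h\<^sub>k\<close> on the nonnegative part of the unit sphere, which exist by
  compactness.

  Everything about \<open>h\<^sub>k\<close> rests on \<open>h\<^sub>k(x, L) - h\<^sub>k(y, L) = (x - y) h\<^sub>k\<^sub>-\<^sub>1(x, y, L)\<close>.  It turns
  the effect of moving a few coordinates along a sphere into an exact product whose sign can be read
  off at the starting point.  Moving two coordinates \<open>a \<noteq> b\<close> along their circle shows that an
  extremal point \<open>W\<close> satisfies
  \<open>h\<^sub>k\<^sub>-\<^sub>1(a, W) = a h\<^sub>k\<^sub>-\<^sub>2(a, b, W)\<close> and \<open>h\<^sub>k\<^sub>-\<^sub>1(b, W) = b h\<^sub>k\<^sub>-\<^sub>2(a, b, W)\<close>.  For three distinct
  positive coordinates these equations give \<open>(b - c) h\<^sub>k\<^sub>-\<^sub>3(a, b, c, W) = 0\<close>, which is impossible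
  for \<open>k \<ge> 3\<close>; for \<open>k = 1, 2\<close> the equations contradict positivity already for two values.  So an
  extremal point has at most two distinct positive coordinates (\<open>extremal_two_values\<close>).  Moving
  \<open>(x, x, y)\<close> to \<open>(x + e, x - e, y')\<close> changes \<open>h\<^sub>k\<close>, to second order, by a positive multiple of
  \<open>x - y\<close> (\<open>extremal_double\<close>).  Hence the larger value of a maximum, and the smaller positive value
  of a minimum, occurs only once.

  A maximum has no zero coordinate, because raising a zero coordinate gains to first order
  (for \<open>k = 0\<close> all moments are 1).  So it is
  a rearrangement of \<open>(s, t, \<dots>, t)\<close> with \<open>0 < t \<le> s\<close>.  The polynomial \<open>g\<close> is, up to a constant
  factor, the difference of the two sides of
  \<open>h\<^sub>k\<^sub>-\<^sub>1(x, W) = x h\<^sub>k\<^sub>-\<^sub>1(1, W)\<close> at \<open>W = (1, x, \<dots>, x)\<close> (\<open>g_eq\<close>), so the two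
  equations above make \<open>t / s\<close> a root; if \<open>s = t\<close> the two sides agree anyway.

  For a minimum one has to exclude \<open>(x, 1, \<dots>, 1)\<close> with \<open>0 < x < 1\<close> and \<open>m\<close> ones, up to scaling and
  zeros.  The moves above do not exclude it, and one follows the curve of all such points.  The
  derivative of the logarithm of \<open>h\<^sub>k(u, 1, \<dots>, 1) / (u\<^sup>2 + m)\<^sup>k\<^sup>/\<^sup>2\<close> has for \<open>0 < u < 1\<close> the sign of
  \<open>\<Sum>\<^sub>j (m - j (K - j)) D\<^sub>K\<^sub>-\<^sub>j u\<^sup>j\<close>, where \<open>K = k - 1\<close> and \<open>D\<^sub>i = h\<^sub>i(1, \<dots>, 1)\<close>.  Its coefficients may
  change from positive to negative and back, so that Descartes' rule would allow two roots; but
  \<open>D\<^sub>K\<^sub>-\<^sub>j u\<^sup>j\<close> decreases in \<open>j\<close> while \<open>m - j (K - j)\<close> is symmetric about \<open>K / 2\<close>, and this forces the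
  derivative of the sum to be negative at each root in \<open>(0, 1)\<close> (\<open>centred_weighted_sum_neg\<close>).
  Thus to the right of a critical point the function decreases, and no such point is minimal.  All
  positive coordinates of a minimum are therefore equal, and its value is \<open>rho m k\<close> for their number
  \<open>m\<close>.
\<close>

section \<open>Complete homogeneous symmetric polynomials\<close>

text \<open>The polynomial \<open>h\<^sub>k\<close>, evaluated at the entries of a list.  Degrees are integers and \<open>h\<^sub>k = 0\<close>
  for \<open>k < 0\<close>, so that the recursions hold in every degree.\<close>

fun hsym :: "int \<Rightarrow> real list \<Rightarrow> real" where
  "hsym k [] = (if k = 0 then 1 else 0)"
| "hsym k (x # xs) = (\<Sum>j\<le>nat k. x ^ j * hsym (k - int j) xs)"

declare hsym.simps(2) [simp del]

lemma hsym_neg [simp]: "k < 0 \<Longrightarrow> hsym k xs = 0"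
  by (induction xs arbitrary: k) (auto simp: hsym.simps)

text \<open>The identity \<open>1 / (1 - x z) = 1 + x z / (1 - x z)\<close> for generating functions.\<close>

lemma hsym_Cons: "hsym k (x # xs) = hsym k xs + x * hsym (k - 1) (x # xs)"
proof (cases "k \<le> 0")
  case True
  then show ?thesis by (simp add: hsym.simps)
next
  case False
  then have "nat k = Suc (nat (k - 1))" by simp
  then show ?thesis
    by (simp add: hsym.simps(2) sum.atMost_Suc_shift sum_distrib_left algebra_simps del: sum.atMost_Suc)
qed

lemma hsym_0 [simp]: "hsym 0 xs = 1"
  by (induction xs) (auto simp: hsym.simps)

lemma hsym_1: "hsym 1 xs = sum_list xs"
  by (induction xs) (auto simp: hsym_Cons[of 1])

lemma hsym_Cons_0 [simp]: "hsym k (0 # xs) = hsym k xs"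
  using hsym_Cons[of k 0 xs] by simp

lemma hsym_nonneg: "(\<And>x. x \<in> set xs \<Longrightarrow> 0 \<le> x) \<Longrightarrow> 0 \<le> hsym k xs"
  by (induction xs arbitrary: k) (auto simp: hsym.simps intro!: sum_nonneg)


text \<open>The generating function of \<open>hsym k (x # y # xs)\<close> is that of \<open>hsym k xs\<close> divided by
  \<open>1 - (x + y) z + x y z\<^sup>2\<close>, which is symmetric in \<open>x\<close> and \<open>y\<close>.\<close>

lemma hsym_Cons2:
  "hsym k (x # y # xs) =
     hsym k xs + (x + y) * hsym (k - 1) (x # y # xs) - x * y * hsym (k - 2) (x # y # xs)"
proof -
  have "hsym (k - 1) (y # xs) = hsym (k - 1) (x # y # xs) - x * hsym (k - 2) (x # y # xs)"
    using hsym_Cons[of "k - 1" x "y # xs"] by simp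
  then have "y * hsym (k - 1) (y # xs) =
      y * hsym (k - 1) (x # y # xs) - x * y * hsym (k - 2) (x # y # xs)"
    by (simp only: right_diff_distrib mult_ac)
  moreover have "hsym k (x # y # xs) =
      hsym k xs + y * hsym (k - 1) (y # xs) + x * hsym (k - 1) (x # y # xs)"
    using hsym_Cons[of k x "y # xs"] hsym_Cons[of k y xs] by linarith
  ultimately show ?thesis by (simp only: distrib_right)
qed

lemma hsym_swap: "hsym k (x # y # xs) = hsym k (y # x # xs)"
proof (induction "nat (k + 1)" arbitrary: k rule: less_induct)
  case less
  show ?case
  proof (cases "k < 0")
    case False
    then have "hsym (k - 1) (x # y # xs) = hsym (k - 1) (y # x # xs)"
      "hsym (k - 2) (x # y # xs) = hsym (k - 2) (y # x # xs)"
      by (auto intro!: less)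
    then show ?thesis
      using hsym_Cons2[of k x y xs] hsym_Cons2[of k y x xs] by (metis add.commute mult.commute)
  qed simp
qed

lemma hsym_append_Cons: "hsym k (as @ x # bs) = hsym k (x # as @ bs)"
proof (induction as arbitrary: k)
  case (Cons a as)
  then have "hsym k (a # as @ x # bs) = hsym k (a # x # as @ bs)"
    by (simp add: hsym.simps(2)[of _ a])
  then show ?case by (simp add: hsym_swap)
qed simp

lemma hsym_cong_mset: "mset xs = mset ys \<Longrightarrow> hsym k xs = hsym k ys"
proof (induction xs arbitrary: ys k)
  case (Cons x xs)
  then have "x \<in> set ys" by (metis list.set_intros(1) mset_eq_setD)
  then obtain as bs where ys: "ys = as @ x # bs" by (meson split_list)
  with Cons.prems have "mset xs = mset (as @ bs)" by simp
  from Cons.IH[OF this] show ?case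
    by (simp add: ys hsym_append_Cons hsym.simps(2))
qed simp

text \<open>Both terms arise from \<open>hsym k (x # y # xs)\<close> by removing one entry.\<close>

lemma hsym_diff: "hsym k (x # xs) - hsym k (y # xs) = (x - y) * hsym (k - 1) (x # y # xs)"
proof -
  have "hsym k (y # xs) + x * hsym (k - 1) (x # y # xs) =
      hsym k (x # xs) + y * hsym (k - 1) (x # y # xs)"
    by (metis hsym_Cons hsym_swap)
  then show ?thesis by (simp only: left_diff_distrib)
qed

lemma hsym_remove: "hsym k (x # xs) - x * hsym (k - 1) (x # xs) = hsym k xs"
  using hsym_Cons[of k x xs] by simp

lemma hsym_pos:
  assumes "\<And>x. x \<in> set xs \<Longrightarrow> 0 \<le> x" "\<exists>x\<in>set xs. 0 < x" "0 \<le> k"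
  shows "0 < hsym k xs"
proof -
  obtain x where x: "x \<in> set xs" "0 < x" using assms by auto
  then obtain as bs where xs: "xs = as @ x # bs" by (meson split_list)
  from \<open>0 \<le> k\<close> have "0 < hsym k (x # as @ bs)"
  proof (induction k rule: int_ge_induct)
    case (step k)
    have "hsym (k + 1) (x # as @ bs) = hsym (k + 1) (as @ bs) + x * hsym k (x # as @ bs)"
      using hsym_Cons[of "k + 1"] by simp
    moreover have "0 \<le> hsym (k + 1) (as @ bs)"
      using assms xs by (intro hsym_nonneg) auto
    ultimately show ?case using step x by (simp add: add_nonneg_pos)
  qed simp
  then show ?thesis by (simp add: xs hsym_append_Cons)
qed

lemma hsym_filter_nonzero: "hsym k (filter (\<lambda>x. x \<noteq> 0) xs) = hsym k xs"
proof (induction xs arbitrary: k)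
  case (Cons x xs)
  then show ?case by (cases "x = 0") (simp_all add: hsym.simps(2)[of k x])
qed simp

lemma hsym_scale: "hsym k (map ((*) c) xs) = c ^ nat k * hsym k xs"
proof (induction xs arbitrary: k)
  case (Cons x xs)
  have "(c * x) ^ j * hsym (k - int j) (map ((*) c) xs) = c ^ nat k * (x ^ j * hsym (k - int j) xs)"
    if "j \<le> nat k" for j
  proof -
    have "j + nat (k - int j) = nat k" using that by arith
    then have "c ^ nat k = c ^ j * c ^ nat (k - int j)" by (simp flip: power_add)
    then show ?thesis by (simp add: Cons power_mult_distrib)
  qed
  then show ?case by (simp add: hsym.simps(2) sum_distrib_left)
qed simp

lemma tendsto_hsym:
  assumes "list_all2 (\<lambda>f x. (f \<longlongrightarrow> x) F) fs xs"
  shows "((\<lambda>t. hsym k (map (\<lambda>f. f t) fs)) \<longlongrightarrow> hsym k xs) F"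
  using assms
proof (induction fs xs arbitrary: k rule: list_all2_induct)
  case (Cons f fs x xs)
  then show ?case unfolding list.map hsym.simps(2) by (intro tendsto_intros)
qed simp

lemma continuous_on_hsym:
  assumes "\<And>i. i \<in> set is \<Longrightarrow> continuous_on S (\<lambda>a. f a i)"
  shows "continuous_on S (\<lambda>a. hsym k (map (f a) is))"
  using assms
proof (induction "is" arbitrary: k)
  case (Cons i "is")
  have "continuous_on S (\<lambda>a. hsym k (map (f a) is))" for k
    by (rule Cons.IH) (use Cons.prems in simp)
  moreover have "continuous_on S (\<lambda>a. f a i)" using Cons.prems by simp
  ultimately show ?case unfolding list.map hsym.simps(2) by (intro continuous_intros)
qed simp

text \<open>The limit of the difference quotient \<open>hsym_diff\<close>: differentiation repeats the entry.\<close>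

lemma DERIV_hsym:
  "((\<lambda>x. hsym k (x # xs)) has_real_derivative hsym (k - 1) (x # x # xs)) (at x)"
proof -
  have "((\<lambda>y. hsym (k - 1) (y # x # xs)) \<longlongrightarrow> hsym (k - 1) (x # x # xs)) (at x)"
    unfolding hsym.simps(2)[of _ _ "x # xs"] by (intro tendsto_intros)
  moreover have "(hsym k (y # xs) - hsym k (x # xs)) / (y - x) = hsym (k - 1) (y # x # xs)"
    if "y \<noteq> x" for y
    using that by (simp add: hsym_diff)
  ultimately show ?thesis
    unfolding has_field_derivative_iff
    by (auto simp: eventually_at_filter elim: Lim_transform_eventually)
qed

section \<open>Moving coordinates along a sphere\<close>

text \<open>The generating functions of the two polynomials have the denominators \<open>1 - (a' + b') z + a' b' z\<^sup>2\<close>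
  and \<open>1 - (a + b) z + a b z\<^sup>2\<close>; over a common denominator their difference is linear in the
  differences of the sums and of the products.\<close>

lemma hsym_pair_diff:
  "hsym k (a' # b' # xs) - hsym k (a # b # xs) =
     (a' + b' - (a + b)) * hsym (k - 1) (a' # b' # a # b # xs)
     - (a' * b' - a * b) * hsym (k - 2) (a' # b' # a # b # xs)"
proof -
  have perm: "hsym j (a # b # a' # b' # xs) = hsym j (a' # b' # a # b # xs)" for j
    by (rule hsym_cong_mset) simp
  show ?thesis
    using hsym_Cons2[of k a' b' "a # b # xs"] hsym_Cons2[of k a b "a' # b' # xs"]
    unfolding perm left_diff_distrib distrib_right by linarith
qed

text \<open>On a circle, sum and product determine each other through \<open>(a + b)\<^sup>2 = a\<^sup>2 + b\<^sup>2 + 2 a b\<close>, so the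
  change factors through the change of \<open>a + b\<close>.\<close>

lemma hsym_pair_diff_circle:
  assumes "a'\<^sup>2 + b'\<^sup>2 = a\<^sup>2 + b\<^sup>2"
  shows "hsym k (a' # b' # xs) - hsym k (a # b # xs) =
     (a' + b' - (a + b)) * (hsym (k - 1) (a' # b' # a # b # xs)
       - (a + b + a' + b') / 2 * hsym (k - 2) (a' # b' # a # b # xs))"
proof -
  have "a' * b' - a * b = (a' + b' - (a + b)) * ((a + b + a' + b') / 2)"
    using assms by (simp add: power2_eq_square algebra_simps)
  then show ?thesis unfolding hsym_pair_diff by (simp only: right_diff_distrib mult.assoc)
qed

lemma eventually_sgn_eq:
  fixes f :: "'a \<Rightarrow> real"
  assumes "(f \<longlongrightarrow> l) F" "l \<noteq> 0"
  shows "\<forall>\<^sub>F x in F. sgn (f x) = sgn l"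
proof (cases "0 < l")
  case True
  show ?thesis
    using order_tendstoD(1)[OF assms(1) True] by eventually_elim (use True in simp)
next
  case False
  then have "l < 0" using assms(2) by simp
  show ?thesis
    using order_tendstoD(2)[OF assms(1) \<open>l < 0\<close>] by eventually_elim (use \<open>l < 0\<close> in simp)
qed

text \<open>The derivative of \<open>hsym k (a # b # xs)\<close> with respect to \<open>a + b\<close> along the circle on which
  \<open>a\<^sup>2 + b\<^sup>2\<close> is constant, by \<open>hsym_pair_diff_circle\<close>.\<close>

definition pair_slope :: "int \<Rightarrow> real \<Rightarrow> real \<Rightarrow> real list \<Rightarrow> real" where
  "pair_slope k a b xs =
     hsym (k - 1) (a # b # a # b # xs) - (a + b) * hsym (k - 2) (a # b # a # b # xs)"

text \<open>Since \<open>a < b\<close>, the sum of the two coordinates grows with the smaller one, at a rate tending to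
  \<open>(b - a) / b\<close>.\<close>

lemma pair_move:
  assumes "0 \<le> a" "a < b" and nz: "pair_slope k a b xs \<noteq> 0"
  shows "\<forall>\<^sub>F d in at 0. \<exists>b'\<ge>0. (a + d)\<^sup>2 + b'\<^sup>2 = a\<^sup>2 + b\<^sup>2 \<and>
           sgn (hsym k ((a + d) # b' # xs) - hsym k (a # b # xs)) = sgn (d * pair_slope k a b xs)"
proof -
  \<comment> \<open>\<open>r d\<close> is the new second coordinate, and \<open>d * c d\<close> the resulting change of the sum.\<close>
  define r where "r d = sqrt (b\<^sup>2 - 2 * a * d - d\<^sup>2)" for d
  define c where "c d = (r d + b - 2 * a - d) / (r d + b)" for d
  define B where "B d = hsym (k - 1) ((a + d) # r d # a # b # xs)
       - (a + b + (a + d) + r d) / 2 * hsym (k - 2) ((a + d) # r d # a # b # xs)" for d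
  have "0 < b" using assms by simp
  have lim: "((\<lambda>d. b\<^sup>2 - 2 * a * d - d\<^sup>2) \<longlongrightarrow> b\<^sup>2) (at 0)" by (rule tendsto_eq_intros refl | simp)+
  then have r: "(r \<longlongrightarrow> b) (at 0)"
    unfolding r_def using tendsto_real_sqrt[OF lim] \<open>0 < b\<close> by simp
  have a: "((\<lambda>d. a + d) \<longlongrightarrow> a) (at 0)" by (rule tendsto_eq_intros refl | simp)+
  have c: "(c \<longlongrightarrow> (b - a) / b) (at 0)"
    unfolding c_def by (rule tendsto_eq_intros r refl | use \<open>0 < b\<close> in \<open>simp add: field_simps\<close>)+
  have h: "((\<lambda>d. hsym j ((a + d) # r d # a # b # xs)) \<longlongrightarrow> hsym j (a # b # a # b # xs)) (at 0)" for j
    using tendsto_hsym[of "at 0" "(\<lambda>d. a + d) # r # map (\<lambda>x _. x) (a # b # xs)" "a # b # a # b # xs" j]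
      a r by (simp add: list_all2_map1 list_all2_same o_def)
  have "(B \<longlongrightarrow> hsym (k - 1) (a # b # a # b # xs)
       - (a + b + a + b) / 2 * hsym (k - 2) (a # b # a # b # xs)) (at 0)"
    unfolding B_def by (intro tendsto_intros h r a)
       (use a r in \<open>auto intro!: tendsto_eq_intros\<close>)
  moreover have "(a + b + a + b) / 2 = a + b" by simp
  ultimately have B: "(B \<longlongrightarrow> pair_slope k a b xs) (at 0)"
    by (simp only: pair_slope_def)
  have pos: "0 < (b - a) / b" using assms by simp
  have "\<forall>\<^sub>F d in at 0. sgn (c d * B d) = sgn ((b - a) / b * pair_slope k a b xs)"
    by (rule eventually_sgn_eq[OF tendsto_mult[OF c B]]) (use pos nz in auto)
  moreover have "\<forall>\<^sub>F d in at 0. 0 < b\<^sup>2 - 2 * a * d - d\<^sup>2"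
    using order_tendstoD(1)[OF lim, of 0] \<open>0 < b\<close> by simp
  ultimately show ?thesis
  proof eventually_elim
    case (elim d)
    have "0 < r d" and r2: "(r d)\<^sup>2 = b\<^sup>2 - 2 * a * d - d\<^sup>2" using elim by (simp_all add: r_def)
    then have circle: "(a + d)\<^sup>2 + (r d)\<^sup>2 = a\<^sup>2 + b\<^sup>2"
      by (simp add: power2_eq_square algebra_simps)
    have "(r d - b) * (r d + b) = - d * (2 * a + d)"
      using r2 by (simp add: power2_eq_square algebra_simps)
    then have "a + d + r d - (a + b) = d * c d"
      using \<open>0 < r d\<close> \<open>0 < b\<close> unfolding c_def by (simp add: field_simps)
    then have "hsym k ((a + d) # r d # xs) - hsym k (a # b # xs) = d * (c d * B d)"
      unfolding hsym_pair_diff_circle[OF circle] B_def by (simp add: add_ac)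
    then have "sgn (hsym k ((a + d) # r d # xs) - hsym k (a # b # xs)) = sgn (d * pair_slope k a b xs)"
      using elim(1) assms \<open>0 < b\<close> by (simp add: sgn_mult)
    with circle \<open>0 < r d\<close> show ?case by (intro exI[of _ "r d"]) auto
  qed
qed

text \<open>The first split of \<open>x\<close> leaves the sum of the two coordinates unchanged and lowers their product
  by \<open>e\<^sup>2\<close>; restoring the sum of squares costs \<open>y - y' \<approx> e\<^sup>2 / y\<close>.  Both effects are exact multiples
  of \<open>e\<^sup>2\<close>, so their difference decides the sign.\<close>

lemma triple_move:
  assumes "0 < y"
    and nz: "hsym (k - 2) (x # x # x # x # y # xs) - hsym (k - 1) (y # y # x # x # xs) / y \<noteq> 0"
      (is "?T \<noteq> 0")
  shows "\<forall>\<^sub>F e in at 0. \<exists>y'\<ge>0. (x + e)\<^sup>2 + (x - e)\<^sup>2 + y'\<^sup>2 = x\<^sup>2 + x\<^sup>2 + y\<^sup>2 \<and>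
           sgn (hsym k ((x + e) # (x - e) # y' # xs) - hsym k (x # x # y # xs)) = sgn ?T"
proof -
  define r where "r e = sqrt (y\<^sup>2 - 2 * e\<^sup>2)" for e
  define B where "B e = hsym (k - 2) ((x + e) # (x - e) # x # x # y # xs)
       - hsym (k - 1) (r e # y # (x + e) # (x - e) # xs) * (2 / (r e + y))" for e
  have lim: "((\<lambda>e. y\<^sup>2 - 2 * e\<^sup>2) \<longlongrightarrow> y\<^sup>2) (at 0)" by (rule tendsto_eq_intros refl | simp)+
  then have r: "(r \<longlongrightarrow> y) (at 0)"
    unfolding r_def using tendsto_real_sqrt[OF lim] \<open>0 < y\<close> by simp
  have x: "((\<lambda>e. x + e) \<longlongrightarrow> x) (at 0)" "((\<lambda>e. x - e) \<longlongrightarrow> x) (at 0)"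
    by (rule tendsto_eq_intros refl | simp)+
  have h1: "((\<lambda>e. hsym (k - 2) ((x + e) # (x - e) # x # x # y # xs))
      \<longlongrightarrow> hsym (k - 2) (x # x # x # x # y # xs)) (at 0)"
    using tendsto_hsym[of "at 0" "(\<lambda>e. x + e) # (\<lambda>e. x - e) # map (\<lambda>x _. x) (x # x # y # xs)"
        "x # x # x # x # y # xs" "k - 2"] x
    by (simp add: list_all2_map1 list_all2_same o_def)
  have h2: "((\<lambda>e. hsym (k - 1) (r e # y # (x + e) # (x - e) # xs))
      \<longlongrightarrow> hsym (k - 1) (y # y # x # x # xs)) (at 0)"
    using tendsto_hsym[of "at 0" "r # (\<lambda>_. y) # (\<lambda>e. x + e) # (\<lambda>e. x - e) # map (\<lambda>x _. x) xs"
        "y # y # x # x # xs" "k - 1"] x r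
    by (simp add: list_all2_map1 list_all2_same o_def)
  have "(B \<longlongrightarrow> hsym (k - 2) (x # x # x # x # y # xs)
      - hsym (k - 1) (y # y # x # x # xs) * (2 / (y + y))) (at 0)"
    unfolding B_def by (intro tendsto_intros h1 h2 r) (use \<open>0 < y\<close> in simp)
  then have B: "(B \<longlongrightarrow> ?T) (at 0)" using \<open>0 < y\<close> by simp
  have "\<forall>\<^sub>F e in at 0. sgn (B e) = sgn ?T"
    by (rule eventually_sgn_eq[OF B nz])
  moreover have "\<forall>\<^sub>F e in at 0. 0 < y\<^sup>2 - 2 * e\<^sup>2"
    using order_tendstoD(1)[OF lim, of 0] \<open>0 < y\<close> by simp
  moreover have "\<forall>\<^sub>F e in at (0::real). e \<noteq> 0" by (simp add: eventually_at_filter)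
  ultimately show ?thesis
  proof eventually_elim
    case (elim e)
    have "0 < r e" and r2: "(r e)\<^sup>2 = y\<^sup>2 - 2 * e\<^sup>2" using elim by (simp_all add: r_def)
    have "(r e - y) * (r e + y) = - (2 * e\<^sup>2)"
      using r2 by (simp add: power2_eq_square algebra_simps)
    then have *: "r e - y = - (e\<^sup>2 * (2 / (r e + y)))"
      using \<open>0 < r e\<close> \<open>0 < y\<close> by (simp add: field_simps)
    define q where "q = 2 / (r e + y)"
    have "r e - y = - (e\<^sup>2 * q)"
      unfolding q_def by (rule *)
    then have "hsym k (r e # (x + e) # (x - e) # xs) - hsym k (y # (x + e) # (x - e) # xs)
        = - (e\<^sup>2 * q) * hsym (k - 1) (r e # y # (x + e) # (x - e) # xs)"
      by (simp only: hsym_diff)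
    moreover have "hsym k ((x + e) # (x - e) # y # xs) - hsym k (x # x # y # xs) =
        e\<^sup>2 * hsym (k - 2) ((x + e) # (x - e) # x # x # y # xs)"
      unfolding hsym_pair_diff by (simp add: power2_eq_square algebra_simps)
    moreover have "hsym k (z # (x + e) # (x - e) # xs) = hsym k ((x + e) # (x - e) # z # xs)" for z
      by (rule hsym_cong_mset) simp
    ultimately have "hsym k ((x + e) # (x - e) # r e # xs) - hsym k (x # x # y # xs) = e\<^sup>2 * B e"
      by (simp add: B_def q_def[symmetric] right_diff_distrib mult_ac)
    moreover have "sgn (e\<^sup>2) = 1" using elim by (intro sgn_pos) simp
    ultimately have "sgn (hsym k ((x + e) # (x - e) # r e # xs) - hsym k (x # x # y # xs)) = sgn ?T"
      using elim(1) by (simp only: sgn_mult mult_1)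
    moreover have "(x + e)\<^sup>2 + (x - e)\<^sup>2 + (r e)\<^sup>2 = x\<^sup>2 + x\<^sup>2 + y\<^sup>2"
      using r2 by (simp add: power2_eq_square algebra_simps)
    ultimately show ?case using \<open>0 < r e\<close> by (intro exI[of _ "r e"]) auto
  qed
qed

text \<open>The Lagrange conditions, with multiplier \<open>hsym (k - 2) (a # b # a # b # xs)\<close>, for the two
  coordinates of the point \<open>a # b # xs\<close>.\<close>

lemma pair_slope_zero:
  assumes "pair_slope k a b xs = 0"
  shows "hsym (k - 1) (a # a # b # xs) = a * hsym (k - 2) (a # b # a # b # xs)"
    and "hsym (k - 1) (b # a # b # xs) = b * hsym (k - 2) (a # b # a # b # xs)"
proof -
  have p: "hsym j (b # a # a # b # xs) = hsym j (a # b # a # b # xs)" for j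
    by (rule hsym_cong_mset) simp
  show "hsym (k - 1) (a # a # b # xs) = a * hsym (k - 2) (a # b # a # b # xs)"
    using assms hsym_remove[of "k - 1" b "a # a # b # xs"]
    unfolding pair_slope_def p by (simp add: algebra_simps)
  show "hsym (k - 1) (b # a # b # xs) = b * hsym (k - 2) (a # b # a # b # xs)"
    using assms hsym_remove[of "k - 1" a "b # a # b # xs"]
    unfolding pair_slope_def by (simp add: algebra_simps)
qed

text \<open>In degrees 1 and 2 the first Lagrange condition reads \<open>1 = 0\<close> and \<open>2 a + b + \<Sum>xs = a\<close>.  For
  larger degrees the polynomials of degree \<open>k - 3\<close> met below are positive.\<close>

lemma pair_slope_zero_degree:
  assumes "pair_slope k a b xs = 0" "0 < a" "0 < b" "\<And>x. x \<in> set xs \<Longrightarrow> 0 \<le> x" "1 \<le> k"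
  shows "3 \<le> k"
proof (rule ccontr)
  assume "\<not> 3 \<le> k"
  with assms(5) consider "k = 1" | "k = 2" by linarith
  then show False
  proof cases
    case 1
    then show False using pair_slope_zero(1)[OF assms(1)] by simp
  next
    case 2
    moreover have "0 \<le> sum_list xs" using assms(4) by (simp add: sum_list_nonneg)
    ultimately show False
      using pair_slope_zero(1)[OF assms(1)] assms(2,3) by (simp add: hsym_1)
  qed
qed

section \<open>Extremal points on the sphere\<close>

text \<open>The common sum of squares is left arbitrary, so that rescaling a list and deleting zeros from it
  keep it extremal.\<close>

definition competitor :: "real list \<Rightarrow> real list \<Rightarrow> bool" where
  "competitor xs ys \<longleftrightarrow> length ys = length xs \<and> (\<forall>y\<in>set ys. 0 \<le> y)
     \<and> (\<Sum>y\<leftarrow>ys. y\<^sup>2) = (\<Sum>x\<leftarrow>xs. x\<^sup>2)"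

text \<open>A maximum for \<open>\<sigma> = 1\<close>, a minimum for \<open>\<sigma> = -1\<close>.\<close>

definition extremal :: "real \<Rightarrow> int \<Rightarrow> real list \<Rightarrow> bool" where
  "extremal \<sigma> k xs \<longleftrightarrow> (\<forall>x\<in>set xs. 0 \<le> x)
     \<and> (\<forall>ys. competitor xs ys \<longrightarrow> \<sigma> * hsym k ys \<le> \<sigma> * hsym k xs)"

lemma extremal_cong_mset:
  assumes "extremal \<sigma> k xs" "mset xs = mset ys"
  shows "extremal \<sigma> k ys"
proof -
  have "(\<Sum>x\<leftarrow>xs. x\<^sup>2) = (\<Sum>x\<leftarrow>ys. x\<^sup>2)"
    using assms(2) by (metis mset_map sum_mset_sum_list)
  then show ?thesis
    using assms mset_eq_length[OF assms(2)] mset_eq_setD[OF assms(2)] hsym_cong_mset[OF assms(2)]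
    by (simp add: extremal_def competitor_def)
qed

text \<open>A pair of positive coordinates can be moved in both directions along its circle.\<close>

lemma extremal_pair_slope:
  assumes "extremal \<sigma> k (a # b # xs)" "0 < a" "0 < b" "a \<noteq> b" "\<sigma> \<noteq> 0"
  shows "pair_slope k a b xs = 0"
proof -
  have *: "pair_slope k a b xs = 0" if ext: "extremal \<sigma> k (a # b # xs)" and "0 < a" "a < b" for a b
  proof (rule ccontr)
    assume nz: "pair_slope k a b xs \<noteq> 0"
    \<comment> \<open>The direction of a small step that would improve \<open>\<sigma>\<close> times the value.\<close>
    define s where "s = sgn (\<sigma> * pair_slope k a b xs)"
    have s: "s = 1 \<or> s = -1" using nz \<open>\<sigma> \<noteq> 0\<close> by (auto simp: s_def sgn_if)
    have "\<forall>\<^sub>F d in at 0. - a < d" by (rule order_tendstoD(1)[OF tendsto_ident_at]) (use \<open>0 < a\<close> in simp)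
    then have "\<forall>\<^sub>F d in at 0. - a < d \<and> (\<exists>b'\<ge>0. (a + d)\<^sup>2 + b'\<^sup>2 = a\<^sup>2 + b\<^sup>2 \<and>
           sgn (hsym k ((a + d) # b' # xs) - hsym k (a # b # xs)) = sgn (d * pair_slope k a b xs))"
      using pair_move[OF _ _ nz] \<open>0 < a\<close> \<open>a < b\<close> by (simp add: eventually_conj_iff)
    then obtain \<delta> where \<delta>: "0 < \<delta>" "\<And>d. d \<noteq> 0 \<Longrightarrow> \<bar>d\<bar> < \<delta> \<Longrightarrow> - a < d \<and> (\<exists>b'\<ge>0. (a + d)\<^sup>2 + b'\<^sup>2 = a\<^sup>2 + b\<^sup>2 \<and>
           sgn (hsym k ((a + d) # b' # xs) - hsym k (a # b # xs)) = sgn (d * pair_slope k a b xs))"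
      unfolding eventually_at by (auto simp: dist_real_def)
    define d where "d = s * (\<delta> / 2)"
    have d: "d \<noteq> 0" "\<bar>d\<bar> < \<delta>" "sgn d = s" using s \<open>0 < \<delta>\<close> by (auto simp: d_def sgn_if)
    with \<delta>(2)[of d] obtain b' where b': "0 \<le> b'" "- a < d" "(a + d)\<^sup>2 + b'\<^sup>2 = a\<^sup>2 + b\<^sup>2"
      "sgn (hsym k ((a + d) # b' # xs) - hsym k (a # b # xs)) = sgn (d * pair_slope k a b xs)"
      by blast
    have "competitor (a # b # xs) ((a + d) # b' # xs)"
      using b' ext by (simp add: competitor_def extremal_def add.assoc[symmetric])
    then have "\<sigma> * (hsym k ((a + d) # b' # xs) - hsym k (a # b # xs)) \<le> 0"
      using ext by (simp add: extremal_def right_diff_distrib)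
    then have "sgn (\<sigma> * (hsym k ((a + d) # b' # xs) - hsym k (a # b # xs))) \<le> 0"
      by simp
    then have "s * sgn (\<sigma> * pair_slope k a b xs) \<le> 0"
      using d(3) by (simp add: sgn_mult b'(4) mult_ac)
    then show False using s unfolding s_def[symmetric] by auto
  qed
  show ?thesis
  proof (cases "a < b")
    case False
    with assms have "b < a" by simp
    moreover have "extremal \<sigma> k (b # a # xs)"
      by (rule extremal_cong_mset[OF assms(1)]) simp
    ultimately have "pair_slope k b a xs = 0" using * assms by blast
    moreover have "hsym j (b # a # b # a # xs) = hsym j (a # b # a # b # xs)" for j
      by (rule hsym_cong_mset) simp
    ultimately show ?thesis by (simp add: pair_slope_def add.commute)
  qed (use * assms in blast)
qed

text \<open>A zero coordinate can be moved in one direction only, but there the slope is positive.\<close>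

lemma maximal_all_positive:
  assumes ext: "extremal 1 k (0 # b # xs)" and "0 < b" "1 \<le> k"
  shows False
proof -
  have nonneg: "\<And>x. x \<in> set xs \<Longrightarrow> 0 \<le> x" using ext by (simp add: extremal_def)
  have "pair_slope k 0 b xs = hsym (k - 1) (b # xs)"
    using hsym_remove[of "k - 1" b "b # xs"] hsym_swap[of _ b 0] by (simp add: pair_slope_def)
  also have "0 < \<dots>" using nonneg assms by (intro hsym_pos) auto
  finally have pos: "0 < pair_slope k 0 b xs" .
  have "\<forall>\<^sub>F d in at 0. \<exists>b'\<ge>0. (0 + d)\<^sup>2 + b'\<^sup>2 = 0\<^sup>2 + b\<^sup>2 \<and>
           sgn (hsym k ((0 + d) # b' # xs) - hsym k (0 # b # xs)) = sgn (d * pair_slope k 0 b xs)"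
    using pos assms by (intro pair_move) auto
  then obtain \<delta> where \<delta>: "0 < \<delta>" "\<And>d. d \<noteq> 0 \<Longrightarrow> \<bar>d\<bar> < \<delta> \<Longrightarrow> \<exists>b'\<ge>0. d\<^sup>2 + b'\<^sup>2 = b\<^sup>2 \<and>
           sgn (hsym k (d # b' # xs) - hsym k (0 # b # xs)) = sgn (d * pair_slope k 0 b xs)"
    unfolding eventually_at by (auto simp: dist_real_def)
  from \<delta>(2)[of "\<delta> / 2"] \<open>0 < \<delta>\<close> obtain b' where b': "0 \<le> b'" "(\<delta> / 2)\<^sup>2 + b'\<^sup>2 = b\<^sup>2"
    "sgn (hsym k ((\<delta> / 2) # b' # xs) - hsym k (0 # b # xs)) = 1"
    using pos by (auto simp: sgn_mult)
  have "competitor (0 # b # xs) ((\<delta> / 2) # b' # xs)"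
    using b' ext \<open>0 < \<delta>\<close> by (simp add: competitor_def extremal_def add.assoc[symmetric])
  then have "hsym k ((\<delta> / 2) # b' # xs) \<le> hsym k (0 # b # xs)"
    using ext by (simp add: extremal_def)
  with b'(3) show False by (simp add: sgn_if split: if_splits)
qed

text \<open>The Lagrange conditions of the pairs \<open>(a, b)\<close> and \<open>(a, c)\<close> share the left-hand side
  \<open>hsym (k - 1) (a # a # b # c # xs)\<close>.  Hence the two multipliers agree, while their difference is
  \<open>b - c\<close> times a positive value of degree \<open>k - 3\<close>.\<close>

lemma extremal_two_values:
  assumes ext: "extremal \<sigma> k (a # b # c # xs)"
    and "0 < a" "0 < b" "0 < c" "a \<noteq> b" "a \<noteq> c" "b \<noteq> c" "\<sigma> \<noteq> 0" "1 \<le> k"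
  shows False
proof -
  have nonneg: "\<And>x. x \<in> set xs \<Longrightarrow> 0 \<le> x" using ext by (simp add: extremal_def)
  have ab: "pair_slope k a b (c # xs) = 0"
    by (rule extremal_pair_slope[OF ext]) (use assms in auto)
  have ac: "pair_slope k a c (b # xs) = 0"
    by (rule extremal_pair_slope[OF extremal_cong_mset[OF ext]]) (use assms in auto)
  have "3 \<le> k"
    by (rule pair_slope_zero_degree[OF ab]) (use assms nonneg in auto)
  have "a * hsym (k - 2) (a # b # a # b # c # xs) = hsym (k - 1) (a # a # b # c # xs)"
    using pair_slope_zero(1)[OF ab] by simp
  also have "\<dots> = hsym (k - 1) (a # a # c # b # xs)"
    by (rule hsym_cong_mset) simp
  also have "\<dots> = a * hsym (k - 2) (a # c # a # c # b # xs)"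
    by (rule pair_slope_zero(1)[OF ac])
  finally have "hsym (k - 2) (a # b # a # b # c # xs) = hsym (k - 2) (a # c # a # c # b # xs)"
    using \<open>0 < a\<close> by simp
  moreover have "hsym (k - 2) (a # b # a # b # c # xs) = hsym (k - 2) (b # a # a # b # c # xs)"
    "hsym (k - 2) (a # c # a # c # b # xs) = hsym (k - 2) (c # a # a # b # c # xs)"
    by (rule hsym_cong_mset, simp)+
  ultimately have "(b - c) * hsym (k - 2 - 1) (b # c # a # a # b # c # xs) = 0"
    using hsym_diff[of "k - 2" b "a # a # b # c # xs" c] by simp
  moreover have "0 < hsym (k - 2 - 1) (b # c # a # a # b # c # xs)"
    using assms nonneg \<open>3 \<le> k\<close> by (intro hsym_pos) auto
  ultimately show False using \<open>b \<noteq> c\<close> by simp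
qed

text \<open>By the Lagrange conditions the second-order change in \<open>triple_move\<close> is \<open>x - y\<close> times a positive
  value of degree \<open>k - 3\<close>.\<close>

lemma extremal_double:
  assumes ext: "extremal \<sigma> k (x # x # y # xs)"
    and "0 < x" "0 < y" "x \<noteq> y" "\<sigma> \<noteq> 0" "1 \<le> k"
  shows "\<sigma> * (x - y) \<le> 0"
proof -
  let ?T = "hsym (k - 2) (x # x # x # x # y # xs) - hsym (k - 1) (y # y # x # x # xs) / y"
  have nonneg: "\<And>z. z \<in> set xs \<Longrightarrow> 0 \<le> z" using ext by (simp add: extremal_def)
  have slope: "pair_slope k x y (x # xs) = 0"
    by (rule extremal_pair_slope[OF extremal_cong_mset[OF ext]]) (use assms in auto)
  have "3 \<le> k"
    by (rule pair_slope_zero_degree[OF slope]) (use assms nonneg in auto)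
  have "hsym (k - 1) (y # y # x # x # xs) = hsym (k - 1) (y # x # y # x # xs)"
    by (rule hsym_cong_mset) simp
  also have "\<dots> = y * hsym (k - 2) (x # y # x # y # x # xs)"
    by (rule pair_slope_zero(2)[OF slope])
  also have "hsym (k - 2) (x # y # x # y # x # xs) = hsym (k - 2) (y # x # x # x # y # xs)"
    by (rule hsym_cong_mset) simp
  finally have "?T = hsym (k - 2) (x # x # x # x # y # xs) - hsym (k - 2) (y # x # x # x # y # xs)"
    using \<open>0 < y\<close> by simp
  then have T: "?T = (x - y) * hsym (k - 3) (x # y # x # x # x # y # xs)"
    using hsym_diff[of "k - 2" x "x # x # x # y # xs" y] by simp
  have P: "0 < hsym (k - 3) (x # y # x # x # x # y # xs)"
    using assms nonneg \<open>3 \<le> k\<close> by (intro hsym_pos) auto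
  have nz: "?T \<noteq> 0" using T P \<open>x \<noteq> y\<close> by simp
  have "\<forall>\<^sub>F e in at 0. - x < e" "\<forall>\<^sub>F e in at 0. e < x"
    by (rule order_tendstoD[OF tendsto_ident_at], use \<open>0 < x\<close> in simp)+
  with triple_move[OF \<open>0 < y\<close> nz]
  have "\<forall>\<^sub>F e in at 0. - x < e \<and> e < x \<and> (\<exists>y'\<ge>0. (x + e)\<^sup>2 + (x - e)\<^sup>2 + y'\<^sup>2 = x\<^sup>2 + x\<^sup>2 + y\<^sup>2 \<and>
      sgn (hsym k ((x + e) # (x - e) # y' # xs) - hsym k (x # x # y # xs)) = sgn ?T)"
    by eventually_elim blast
  then obtain e where "- x < e \<and> e < x \<and> (\<exists>y'\<ge>0. (x + e)\<^sup>2 + (x - e)\<^sup>2 + y'\<^sup>2 = x\<^sup>2 + x\<^sup>2 + y\<^sup>2 \<and>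
      sgn (hsym k ((x + e) # (x - e) # y' # xs) - hsym k (x # x # y # xs)) = sgn ?T)"
    using eventually_happens'[OF trivial_limit_at] by blast
  then obtain y' where e: "- x < e" "e < x" "0 \<le> y'"
    "(x + e)\<^sup>2 + (x - e)\<^sup>2 + y'\<^sup>2 = x\<^sup>2 + x\<^sup>2 + y\<^sup>2"
    "sgn (hsym k ((x + e) # (x - e) # y' # xs) - hsym k (x # x # y # xs)) = sgn ?T"
    by blast
  have "competitor (x # x # y # xs) ((x + e) # (x - e) # y' # xs)"
    using e ext by (simp add: competitor_def extremal_def add.assoc[symmetric])
  then have "\<sigma> * (hsym k ((x + e) # (x - e) # y' # xs) - hsym k (x # x # y # xs)) \<le> 0"
    using ext by (simp add: extremal_def right_diff_distrib)
  then have "sgn (\<sigma> * (hsym k ((x + e) # (x - e) # y' # xs) - hsym k (x # x # y # xs))) \<le> 0"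
    by simp
  then have "sgn (\<sigma> * (x - y)) \<le> 0"
    using P unfolding sgn_mult e(5) T by simp
  then show ?thesis by simp
qed

section \<open>The curve of points with one coordinate different from the rest\<close>

lemma hsym_Cons_sum:
  "k \<le> int N \<Longrightarrow> hsym k (x # xs) = (\<Sum>j\<le>N. x ^ j * hsym (k - int j) xs)"
  unfolding hsym.simps(2)
proof (intro sum.mono_neutral_left ballI)
  fix j assume "j \<in> {..N} - {..nat k}"
  then have "k - int j < 0" by (simp add: nat_less_iff) linarith
  then show "x ^ j * hsym (k - int j) xs = 0" by simp
qed auto

text \<open>Repeating an entry replaces \<open>1 / (1 - x z)\<close> by \<open>1 / (1 - x z)\<^sup>2\<close> in the generating function.\<close>

lemma hsym_double_sum:
  "k \<le> int N \<Longrightarrow> hsym k (x # x # xs) = (\<Sum>j\<le>N. (real j + 1) * x ^ j * hsym (k - int j) xs)"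
proof (induction N arbitrary: k)
  case 0
  then show ?case by (cases "k = 0") auto
next
  case (Suc N)
  have "hsym k (x # x # xs) = hsym k (x # xs) + x * hsym (k - 1) (x # x # xs)"
    by (rule hsym_Cons)
  also have "hsym k (x # xs) = (\<Sum>j\<le>Suc N. x ^ j * hsym (k - int j) xs)"
    using Suc.prems by (rule hsym_Cons_sum)
  also have "hsym (k - 1) (x # x # xs) = (\<Sum>j\<le>N. (real j + 1) * x ^ j * hsym (k - 1 - int j) xs)"
    using Suc.prems by (intro Suc.IH) simp
  finally show ?case
    by (simp add: sum.atMost_Suc_shift sum_distrib_left sum.distrib algebra_simps del: sum.atMost_Suc)
qed

lemma hsym_ones: "hsym (int i) (replicate (Suc m) 1) = real ((i + m) choose m)"
proof (induction m arbitrary: i)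
  case 0
  show ?case by (simp add: hsym.simps(2) sum.delta' if_distrib cong: if_cong)
next
  case (Suc m)
  note IH = this
  show ?case
  proof (induction i)
    case (Suc i)
    have "hsym (int (Suc i)) (replicate (Suc (Suc m)) 1) =
        hsym (int (Suc i)) (replicate (Suc m) 1) + hsym (int i) (replicate (Suc (Suc m)) 1)"
      using hsym_Cons[of "int (Suc i)" 1 "replicate (Suc m) 1"] by simp
    also have "\<dots> = real (Suc i + m choose m) + real (i + Suc m choose Suc m)"
      unfolding IH Suc.IH ..
    finally show ?case by simp
  qed simp
qed

lemma hsym_ones_upper:
  assumes "1 \<le> m" "0 \<le> i"
  shows "real m * hsym i (replicate (Suc m) 1) = (of_int i + real m) * hsym i (replicate m 1)"
proof -
  obtain p where m: "m = Suc p" using assms(1) by (cases m) auto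
  obtain n where i: "i = int n" using assms(2) nonneg_int_cases by blast
  have "Suc p * (Suc (n + p) choose Suc p) = Suc (n + p) * (n + p choose p)"
    by (rule Suc_times_binomial)
  from arg_cong[OF this, of real]
  have "real (Suc p) * real (n + Suc p choose Suc p) = real (n + Suc p) * real (n + p choose p)"
    by (simp only: of_nat_mult add_Suc_right)
  then show ?thesis
    unfolding m i hsym_ones of_int_of_nat_eq of_nat_add[symmetric] .
qed

lemma hsym_ones_lower:
  assumes "1 \<le> m" "0 \<le> i"
  shows "real m * hsym (i - 1) (replicate (Suc m) 1) = of_int i * hsym i (replicate m 1)"
proof -
  have "hsym i (replicate (Suc m) 1) = hsym i (replicate m 1) + hsym (i - 1) (replicate (Suc m) 1)"
    using hsym_Cons[of i 1 "replicate m 1"] by simp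
  then show ?thesis using hsym_ones_upper[OF assms] by (simp add: algebra_simps)
qed

lemma hsym_mono_degree:
  assumes "1 \<le> m" "i \<le> j"
  shows "hsym i (replicate m 1) \<le> hsym j (replicate m 1)"
  using assms(2)
proof (induction j rule: int_ge_induct)
  case (step j)
  obtain p where m: "m = Suc p" using assms(1) by (cases m) auto
  have "hsym (j + 1) (replicate m 1) = hsym (j + 1) (replicate p 1) + hsym j (replicate m 1)"
    using hsym_Cons[of "j + 1" 1 "replicate p 1"] by (simp add: m)
  moreover have "0 \<le> hsym (j + 1) (replicate p 1)" by (rule hsym_nonneg) simp
  ultimately show ?case using step by linarith
qed simp

text \<open>The coefficients \<open>m - j (K - j)\<close> are symmetric about \<open>K / 2\<close> and increase with the distance of
  \<open>j\<close> from \<open>K / 2\<close>.  After folding \<open>j\<close> onto \<open>K - j\<close>, the hypothesis is a weighted sum with weights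
  \<open>w j + w (K - j)\<close>, and the claim one with the additional factor
  \<open>(j - K / 2) (w j - w (K - j)) / (w j + w (K - j))\<close>, which decreases with that distance.  The claim
  is thus an instance of Chebyshev's sum inequality, obtained by comparing the factor with its
  value at the index where the coefficients change sign.\<close>

lemma centred_weighted_sum_neg:
  fixes w :: "nat \<Rightarrow> real" and m :: real
  assumes "0 < m" and pos: "\<And>j. j \<le> K \<Longrightarrow> 0 < w j"
    and dec: "\<And>i j. i < j \<Longrightarrow> j \<le> K \<Longrightarrow> w j < w i"
    and zero: "(\<Sum>j\<le>K. (m - real j * (real K - real j)) * w j) = 0"
  shows "(\<Sum>j\<le>K. real j * ((m - real j * (real K - real j)) * w j)) < 0"
proof -
  \<comment> \<open>Weights and coefficients are compared at the mirror indices \<open>j\<close> and \<open>K - j\<close>.\<close>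
  define b where "b j = m - real j * (real K - real j)" for j
  define c where "c j = real j - real K / 2" for j
  define d where "d j = w j - w (K - j)" for j
  define s where "s j = w j + w (K - j)" for j
  have b_c: "b j = (c j)\<^sup>2 + (m - (real K / 2)\<^sup>2)" for j
    by (simp add: b_def c_def power2_eq_square algebra_simps)
  have refl_c: "c (K - j) = - c j" if "j \<le> K" for j
    using that by (simp add: c_def of_nat_diff field_simps)
  have refl_b: "b (K - j) = b j" if "j \<le> K" for j
    using that by (simp add: b_c refl_c)
  have refl_d: "d (K - j) = - d j" if "j \<le> K" for j
    using that by (simp add: d_def)
  have refl_s: "s (K - j) = s j" if "j \<le> K" for j
    using that by (simp add: s_def add.commute)
  have s_pos: "0 < s j" if "j \<le> K" for j
    using pos[OF that] pos[of "K - j"] by (simp add: s_def)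
  have rev: "(\<Sum>j\<le>K. f (K - j)) = (\<Sum>j\<le>K. f j)" for f :: "nat \<Rightarrow> real"
    by (rule sum.reindex_bij_witness[of _ "\<lambda>j. K - j" "\<lambda>j. K - j"]) auto
  have bw: "(\<Sum>j\<le>K. b j * w j) = 0" using zero by (simp add: b_def)
  have "(\<Sum>j\<le>K. b j * w (K - j)) = (\<Sum>j\<le>K. b (K - j) * w (K - j))"
    by (rule sum.cong) (auto simp: refl_b)
  also have "\<dots> = 0" unfolding rev[of "\<lambda>j. b j * w j"] by (rule bw)
  finally have bs: "(\<Sum>j\<le>K. b j * s j) = 0"
    using bw by (simp add: s_def distrib_left sum.distrib)
  have "(\<Sum>j\<le>K. b j * c j * w (K - j)) = (\<Sum>j\<le>K. - (b (K - j) * c (K - j) * w (K - j)))"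
    by (rule sum.cong) (auto simp: refl_b refl_c)
  also have "\<dots> = - (\<Sum>j\<le>K. b j * c j * w j)"
    unfolding sum_negf rev[of "\<lambda>j. b j * c j * w j"] ..
  finally have bcd: "(\<Sum>j\<le>K. b j * (c j * d j)) = 2 * (\<Sum>j\<le>K. b j * c j * w j)"
    by (simp add: d_def right_diff_distrib sum_subtractf mult.assoc)
  have half: "c j * d j * s i < c i * d i * s j" if "K \<le> 2 * i" "i < j" "j \<le> K" for i j
  proof -
    have c: "0 \<le> c i" "c i < c j" using that by (auto simp: c_def)
    have "d j < 0" using dec[of "K - j" j] that by (simp add: d_def)
    then have ds: "d j * s i < 0" using s_pos[of i] that by (simp add: mult_neg_pos)
    have "w j < w i" using dec that by simp
    moreover have "w (K - i) < w (K - j)" using dec[of "K - j" "K - i"] that by simp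
    ultimately have "w j * w (K - i) \<le> w i * w (K - j)"
      using pos[of i] pos[of "K - i"] that by (intro mult_mono) auto
    then have "d j * s i \<le> d i * s j" by (simp add: d_def s_def algebra_simps)
    then have "c i * (d j * s i) \<le> c i * (d i * s j)" using c by (intro mult_left_mono)
    moreover have "c j * (d j * s i) < c i * (d j * s i)"
      using c ds by (intro mult_strict_right_mono_neg)
    ultimately show ?thesis by (simp add: mult.assoc)
  qed
  have cmp: "c j * d j * s i < c i * d i * s j" if "(c i)\<^sup>2 < (c j)\<^sup>2" "i \<le> K" "j \<le> K" for i j
  proof -
    \<comment> \<open>The product of \<open>c\<close> and \<open>d\<close>, the square of \<open>c\<close>, and \<open>s\<close> are invariant under \<open>j \<mapsto> K - j\<close>, so
      both indices may be moved to the upper half.\<close>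
    define u where "u l = max l (K - l)" for l
    have u: "c (u l) * d (u l) = c l * d l" "s (u l) = s l" "(c (u l))\<^sup>2 = (c l)\<^sup>2"
        "K \<le> 2 * u l" "u l \<le> K" if "l \<le> K" for l
      using that refl_c[OF that] refl_d[OF that] refl_s[OF that] by (auto simp: u_def max_def)
    have "0 \<le> c (u i)" "0 \<le> c (u j)" using u(4)[OF \<open>i \<le> K\<close>] u(4)[OF \<open>j \<le> K\<close>] by (auto simp: c_def)
    moreover have "(c (u i))\<^sup>2 < (c (u j))\<^sup>2" using u(3) that by simp
    ultimately have "c (u i) < c (u j)" using power2_less_imp_less by blast
    then have "u i < u j" by (simp add: c_def)
    then show ?thesis using half[of "u i" "u j"] u that by simp
  qed
  have K0: "0 < b 0" using \<open>0 < m\<close> by (simp add: b_def)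
  have "\<exists>j\<le>K. b j \<le> 0"
  proof (rule ccontr)
    assume "\<not> ?thesis"
    then have "0 < b j" if "j \<le> K" for j using that by (meson not_le)
    then have "0 < (\<Sum>j\<le>K. b j * w j)"
      using pos by (intro sum_pos mult_pos_pos) (auto simp: not_le)
    with bw show False by simp
  qed
  then have ne: "{j. j \<le> K \<and> b j \<le> 0} \<noteq> {}" "finite {j. j \<le> K \<and> b j \<le> 0}" by auto
  \<comment> \<open>The threshold \<open>p\<close>: the nonpositive coefficients are those with indices at most as far from \<open>K / 2\<close>.\<close>
  then have "Max (b ` {j. j \<le> K \<and> b j \<le> 0}) \<in> b ` {j. j \<le> K \<and> b j \<le> 0}"
    by (intro Max_in) auto
  then obtain p where p: "p \<le> K" "b p \<le> 0" "b p = Max (b ` {j. j \<le> K \<and> b j \<le> 0})"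
    by auto
  have p_max: "b j \<le> b p" if "j \<le> K" "b j \<le> 0" for j
    unfolding p(3) using that ne(2) by (intro Max_ge) auto
  have term_le: "b j * (c j * d j * s p - c p * d p * s j) \<le> 0" if "j \<le> K" for j
  proof (cases "0 < b j")
    case True
    then have "(c p)\<^sup>2 < (c j)\<^sup>2" using p(2) unfolding b_c by linarith
    with cmp[OF this p(1) that] True show ?thesis by (simp add: mult_nonneg_nonpos)
  next
    case False
    then have "(c j)\<^sup>2 \<le> (c p)\<^sup>2" using p_max[OF that] unfolding b_c by linarith
    then consider "(c j)\<^sup>2 < (c p)\<^sup>2" | "c j = c p" | "c j = - c p"
      by (force simp: power2_eq_iff order_le_less)
    then have "c p * d p * s j \<le> c j * d j * s p"
    proof cases
      case 1
      with cmp[OF this that p(1)] show ?thesis by simp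
    next
      case 2
      then have "j = p" by (simp add: c_def)
      then show ?thesis by simp
    next
      case 3
      then have "j = K - p" using p(1) by (simp add: c_def)
      then show ?thesis using p(1) by (simp add: refl_c refl_d refl_s)
    qed
    then show ?thesis using False by (simp add: mult_nonpos_nonneg)
  qed
  have term_0: "b 0 * (c 0 * d 0 * s p - c p * d p * s 0) < 0"
  proof -
    have "(c p)\<^sup>2 < (c 0)\<^sup>2" using p(2) K0 unfolding b_c by linarith
    from cmp[OF this p(1)] K0 show ?thesis by (simp add: mult_pos_neg)
  qed
  have "(\<Sum>j\<le>K. b j * (c j * d j * s p - c p * d p * s j)) < (\<Sum>j\<le>K. 0)"
    by (rule sum_strict_mono_ex1) (use term_le term_0 in auto)
  moreover have "(\<Sum>j\<le>K. b j * (c j * d j * s p - c p * d p * s j)) =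
      s p * (\<Sum>j\<le>K. b j * (c j * d j)) - c p * d p * (\<Sum>j\<le>K. b j * s j)"
    unfolding sum_distrib_left sum_subtractf[symmetric] by (rule sum.cong) (auto simp: algebra_simps)
  ultimately have "s p * (\<Sum>j\<le>K. b j * (c j * d j)) < 0" using bs by simp
  then have "(\<Sum>j\<le>K. b j * c j * w j) < 0"
    using s_pos[OF p(1)] bcd by (simp add: mult_less_0_iff)
  moreover have "(\<Sum>j\<le>K. b j * c j * w j) =
      (\<Sum>j\<le>K. real j * (b j * w j)) - real K / 2 * (\<Sum>j\<le>K. b j * w j)"
    unfolding sum_distrib_left sum_subtractf[symmetric]
    by (rule sum.cong) (auto simp: c_def algebra_simps)
  ultimately show ?thesis using bw by (simp add: b_def)
qed

text \<open>The right-hand side is the expansion in powers of \<open>u\<close>, with the coefficients brought to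
  the common factor \<open>hsym (K - j) (replicate m 1)\<close>.  The left-hand side is \<open>m\<close> times the difference
  between the two sides of a Lagrange condition at the point \<open>(u, 1, \<dots>, 1)\<close>.\<close>

lemma lagrange_difference_expansion:
  assumes "1 \<le> m"
  shows "real m * (hsym (int K) (u # replicate (Suc m) 1)
             - hsym (int K - 1) (u # u # replicate (Suc m) 1)) =
      (\<Sum>j\<le>K. (real m - real j * (real K - real j)) * hsym (int K - int j) (replicate m 1) * u ^ j)"
proof -
  let ?D = "\<lambda>i. hsym i (replicate m 1)" and ?E = "\<lambda>i. hsym i (replicate (Suc m) 1)"
  have E: "real m * ?E (int K - int j) = (real K - real j + real m) * ?D (int K - int j)"
    "real m * ?E (int K - 1 - int j) = (real K - real j) * ?D (int K - int j)" if "j \<le> K" for j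
    using that hsym_ones_upper[OF assms, of "int K - int j"] hsym_ones_lower[OF assms, of "int K - int j"]
    by (simp_all add: algebra_simps)
  have "real m * (hsym (int K) (u # replicate (Suc m) 1)
             - hsym (int K - 1) (u # u # replicate (Suc m) 1)) =
      (\<Sum>j\<le>K. u ^ j * (real m * ?E (int K - int j)) - (real j + 1) * u ^ j * (real m * ?E (int K - 1 - int j)))"
    unfolding hsym_Cons_sum[OF order_refl] hsym_double_sum[of "int K - 1" K, simplified]
      sum_distrib_left sum_subtractf[symmetric]
    by (intro sum.cong) (simp_all only: algebra_simps)
  also have "\<dots> = (\<Sum>j\<le>K. (real m - real j * (real K - real j)) * ?D (int K - int j) * u ^ j)"
    by (intro sum.cong refl) (simp only: E atMost_iff, simp add: algebra_simps)
  finally show ?thesis .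
qed

text \<open>The left-hand side is the numerator of the logarithmic derivative of
  \<open>hsym (K + 1) (u # replicate m 1) / (u\<^sup>2 + m)\<^sup>(\<^sup>K\<^sup>+\<^sup>1\<^sup>)\<^sup>/\<^sup>2\<close>.  The factor \<open>1 - u\<close> appears because
  the point with all coordinates equal is critical.  The proof combines Euler's identity for
  homogeneous polynomials with the removal of entries.\<close>

lemma log_derivative_numerator:
  assumes "1 \<le> m"
  shows "(u\<^sup>2 + real m) * hsym (int K) (u # u # replicate m 1)
          - real (Suc K) * u * hsym (int K + 1) (u # replicate m 1)
       = real m * (1 - u) * (hsym (int K) (u # replicate (Suc m) 1)
             - hsym (int K - 1) (u # u # replicate (Suc m) 1))"
proof -
  let ?D = "\<lambda>i. hsym i (replicate m 1)" and ?E = "\<lambda>i. hsym i (replicate (Suc m) 1)"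
  have "hsym (int K + 1) (u # replicate m 1) = (\<Sum>j\<le>Suc K. u ^ j * ?D (int K + 1 - int j))"
    by (rule hsym_Cons_sum) simp
  then have P: "real (Suc K) * hsym (int K + 1) (u # replicate m 1) =
      (\<Sum>j\<le>Suc K. real (Suc K) * (u ^ j * ?D (int K + 1 - int j)))"
    by (simp only: sum_distrib_left)
  have "u * hsym (int K) (u # u # replicate m 1) =
      (\<Sum>j\<le>K. (real j + 1) * u ^ Suc j * ?D (int K - int j))"
    unfolding hsym_double_sum[OF order_refl] sum_distrib_left by (intro sum.cong) (simp_all add: mult_ac)
  also have "\<dots> = (\<Sum>j\<le>Suc K. real j * (u ^ j * ?D (int K + 1 - int j)))"
    unfolding sum.atMost_Suc_shift by (simp add: mult_ac add.commute)
  finally have uP': "u * hsym (int K) (u # u # replicate m 1) =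
      (\<Sum>j\<le>Suc K. real j * (u ^ j * ?D (int K + 1 - int j)))" .
  have "real (Suc K) * hsym (int K + 1) (u # replicate m 1)
      - u * hsym (int K) (u # u # replicate m 1) =
      (\<Sum>j\<le>Suc K. u ^ j * (of_int (int K + 1 - int j) * ?D (int K + 1 - int j)))"
    unfolding P uP' sum_subtractf[symmetric] by (intro sum.cong refl) (simp add: algebra_simps)
  also have "\<dots> = (\<Sum>j\<le>Suc K. real m * (u ^ j * ?E (int K - int j)))"
  proof (intro sum.cong refl)
    fix j assume "j \<in> {..Suc K}"
    then have "0 \<le> int K + 1 - int j" by simp
    from hsym_ones_lower[OF assms this]
    have "real m * ?E (int K - int j) = of_int (int K + 1 - int j) * ?D (int K + 1 - int j)"
      by (simp add: algebra_simps)
    then show "u ^ j * (of_int (int K + 1 - int j) * ?D (int K + 1 - int j)) = real m * (u ^ j * ?E (int K - int j))"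
      by (metis mult.left_commute)
  qed
  also have "\<dots> = real m * hsym (int K) (u # replicate (Suc m) 1)"
    unfolding sum_distrib_left[symmetric] by (subst hsym_Cons_sum[of "int K" "Suc K"]) simp_all
  finally have euler: "real (Suc K) * hsym (int K + 1) (u # replicate m 1) =
      u * hsym (int K) (u # u # replicate m 1) + real m * hsym (int K) (u # replicate (Suc m) 1)"
    by simp
  have "hsym (int K) (u # u # replicate m 1) =
      hsym (int K) (u # u # replicate (Suc m) 1) - hsym (int K - 1) (u # u # replicate (Suc m) 1)"
    using hsym_remove[of "int K" 1 "u # u # replicate m 1"]
      hsym_cong_mset[of "1 # u # u # replicate m 1" "u # u # replicate (Suc m) 1"]
    by simp
  also have "hsym (int K) (u # u # replicate (Suc m) 1) =
      hsym (int K) (u # replicate (Suc m) 1) + u * hsym (int K - 1) (u # u # replicate (Suc m) 1)"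
    by (rule hsym_Cons)
  finally have split: "hsym (int K) (u # u # replicate m 1) = hsym (int K) (u # replicate (Suc m) 1)
      + u * hsym (int K - 1) (u # u # replicate (Suc m) 1) - hsym (int K - 1) (u # u # replicate (Suc m) 1)" .
  have "(u\<^sup>2 + real m) * hsym (int K) (u # u # replicate m 1)
          - real (Suc K) * u * hsym (int K + 1) (u # replicate m 1)
      = (u\<^sup>2 + real m) * hsym (int K) (u # u # replicate m 1)
          - u * (real (Suc K) * hsym (int K + 1) (u # replicate m 1))"
    by (simp only: mult_ac)
  also have "\<dots> = real m * (hsym (int K) (u # u # replicate m 1) - u * hsym (int K) (u # replicate (Suc m) 1))"
    unfolding euler by (simp add: power2_eq_square algebra_simps)
  also have "\<dots> = real m * (1 - u) * (hsym (int K) (u # replicate (Suc m) 1)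
             - hsym (int K - 1) (u # u # replicate (Suc m) 1))"
    unfolding split by (simp add: algebra_simps)
  finally show ?thesis .
qed

text \<open>The logarithm of the value at \<open>(u, 1, \<dots>, 1)\<close> normalized to the unit sphere strictly decreases
  immediately to the right of a critical point \<open>x\<close>.\<close>

lemma critical_point_not_minimal:
  assumes "0 < x" "x < 1" "1 \<le> m"
    and zero: "hsym (int K) (x # replicate (Suc m) 1) = hsym (int K - 1) (x # x # replicate (Suc m) 1)"
  shows "\<exists>u>0. ln (hsym (int K + 1) (u # replicate m 1)) - real (Suc K) / 2 * ln (u\<^sup>2 + real m)
            < ln (hsym (int K + 1) (x # replicate m 1)) - real (Suc K) / 2 * ln (x\<^sup>2 + real m)"
proof -
  define D where "D i = hsym i (replicate m 1)" for i
  define P where "P u = hsym (int K + 1) (u # replicate m 1)" for u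
  define R where "R u = hsym (int K) (u # replicate (Suc m) 1)
             - hsym (int K - 1) (u # u # replicate (Suc m) 1)" for u
  define S where "S u = (\<Sum>j\<le>K. (real m - real j * (real K - real j)) * D (int K - int j) * u ^ j)" for u
  have S: "real m * R u = S u" for u
    unfolding R_def S_def D_def using lagrange_difference_expansion[OF \<open>1 \<le> m\<close>] .
  have D_pos: "0 < D i" if "0 \<le> i" for i
    unfolding D_def using that \<open>1 \<le> m\<close> by (intro hsym_pos) auto
  have S0: "S x = 0" using zero S[of x] by (simp add: R_def)
  have neg: "(\<Sum>j\<le>K. real j * ((real m - real j * (real K - real j)) * (D (int K - int j) * x ^ j))) < 0"
  proof (rule centred_weighted_sum_neg)
    show "0 < D (int K - int j) * x ^ j" if "j \<le> K" for j
      using that D_pos[of "int K - int j"] \<open>0 < x\<close> by simp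
    show "D (int K - int j) * x ^ j < D (int K - int i) * x ^ i" if "i < j" "j \<le> K" for i j
    proof (rule mult_le_less_imp_less)
      show "D (int K - int j) \<le> D (int K - int i)"
        unfolding D_def using that \<open>1 \<le> m\<close> by (intro hsym_mono_degree) auto
      show "x ^ j < x ^ i" using that assms by (simp add: power_strict_decreasing)
      show "0 < D (int K - int j)" using that by (intro D_pos) auto
    qed (use \<open>0 < x\<close> in simp)
    show "(\<Sum>j\<le>K. (real m - real j * (real K - real j)) * (D (int K - int j) * x ^ j)) = 0"
      using S0 by (simp add: S_def mult.assoc)
  qed (use \<open>1 \<le> m\<close> in simp)
  define S' where "S' = (\<Sum>j\<le>K. (real m - real j * (real K - real j)) * D (int K - int j) * (real j * x ^ (j - 1)))"
  have DS: "(S has_real_derivative S') (at x)"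
    unfolding S_def S'_def by (intro DERIV_sum) (use DERIV_cmult[OF DERIV_pow] in simp)
  have "x * S' = (\<Sum>j\<le>K. real j * ((real m - real j * (real K - real j)) * (D (int K - int j) * x ^ j)))"
    unfolding S'_def sum_distrib_left
  proof (intro sum.cong refl)
    fix j
    show "x * ((real m - real j * (real K - real j)) * D (int K - int j) * (real j * x ^ (j - 1))) =
        real j * ((real m - real j * (real K - real j)) * (D (int K - int j) * x ^ j))"
      by (cases j) (simp_all add: mult_ac)
  qed
  then have "S' < 0" using neg \<open>0 < x\<close> by (metis zero_less_mult_pos linorder_not_less mult_less_0_iff less_asym)
  from DERIV_neg_dec_right[OF DS this] obtain \<delta> where \<delta>: "0 < \<delta>" "\<And>h. 0 < h \<Longrightarrow> h < \<delta> \<Longrightarrow> S (x + h) < 0"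
    using S0 by auto
  define u where "u = x + min \<delta> (1 - x) / 2"
  \<comment> \<open>Up to \<open>u\<close> the sum \<open>S\<close> stays negative, and the factor \<open>1 - v\<close> stays positive.\<close>
  have u: "x < u" "u < 1" "u < x + \<delta>" using \<delta>(1) \<open>x < 1\<close> by (auto simp: u_def min_def field_simps)
  have R_neg: "R v < 0" if "x < v" "v < u" for v
  proof -
    have "real m * R v < 0" using \<delta>(2)[of "v - x"] that u S[of v] by simp
    then show ?thesis by (simp add: mult_less_0_iff)
  qed
  define F where "F v = ln (P v) - real (Suc K) / 2 * ln (v\<^sup>2 + real m)" for v
  have P_pos: "0 < P v" if "0 < v" for v
    unfolding P_def using that by (intro hsym_pos) auto
  have q_pos: "0 < v\<^sup>2 + real m" for v :: real
    using \<open>1 \<le> m\<close> by (intro add_nonneg_pos) auto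
  have DF: "(F has_real_derivative
      real m * (1 - v) * R v / (P v * (v\<^sup>2 + real m))) (at v)" if "0 < v" for v
  proof -
    have DP: "(P has_real_derivative hsym (int K) (v # v # replicate m 1)) (at v)"
      unfolding P_def using DERIV_hsym[of "int K + 1"] by simp
    have "((\<lambda>v. ln (P v)) has_real_derivative 1 / P v * hsym (int K) (v # v # replicate m 1)) (at v)"
      by (rule DERIV_chain2[OF DERIV_ln_divide DP]) (rule P_pos[OF that])
    moreover have "((\<lambda>v. ln (v\<^sup>2 + real m)) has_real_derivative 1 / (v\<^sup>2 + real m) * (2 * v)) (at v)"
      by (rule DERIV_chain2[where g = "\<lambda>v. v\<^sup>2 + real m", OF DERIV_ln_divide])
         (use q_pos[of v] in \<open>auto intro!: derivative_eq_intros\<close>)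
    ultimately have "(F has_real_derivative 1 / P v * hsym (int K) (v # v # replicate m 1)
        - real (Suc K) / 2 * (1 / (v\<^sup>2 + real m) * (2 * v))) (at v)"
      unfolding F_def by (intro DERIV_diff DERIV_cmult)
    also have "1 / P v * hsym (int K) (v # v # replicate m 1)
        - real (Suc K) / 2 * (1 / (v\<^sup>2 + real m) * (2 * v)) =
        ((v\<^sup>2 + real m) * hsym (int K) (v # v # replicate m 1) - real (Suc K) * v * P v) / (P v * (v\<^sup>2 + real m))"
    proof -
      have "1 / p * h - c / 2 * (1 / q * (2 * v)) = (q * h - c * v * p) / (p * q)"
        if "p \<noteq> 0" "q \<noteq> 0" for p q h c :: real
        using that by (simp add: field_simps)
      from this[of "P v" "v\<^sup>2 + real m"] show ?thesis
        using P_pos[OF that] q_pos[of v] by (metis less_irrefl)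
    qed
    also have "(v\<^sup>2 + real m) * hsym (int K) (v # v # replicate m 1) - real (Suc K) * v * P v = real m * (1 - v) * R v"
      unfolding P_def R_def using log_derivative_numerator[OF \<open>1 \<le> m\<close>] .
    finally show ?thesis .
  qed
  have "F u < F x"
  proof (rule DERIV_neg_imp_decreasing_open[OF u(1)])
    fix v assume v: "x < v" "v < u"
    have "real m * (1 - v) * R v / (P v * (v\<^sup>2 + real m)) < 0"
      using R_neg[OF v] P_pos[of v] q_pos[of v] v u \<open>0 < x\<close> \<open>1 \<le> m\<close>
      by (intro divide_neg_pos mult_pos_neg mult_pos_pos) auto
    then show "\<exists>y. (F has_real_derivative y) (at v) \<and> y < 0"
      using DF[of v] v \<open>0 < x\<close> by (intro exI conjI) auto
  next
    show "continuous_on {x..u} F"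
      using \<open>0 < x\<close> by (intro continuous_at_imp_continuous_on ballI DERIV_isCont[OF DF]) auto
  qed
  then show ?thesis using u \<open>0 < x\<close> unfolding F_def P_def by (intro exI[of _ u]) auto
qed

lemma minimal_not_mixed_unit:
  assumes ext: "extremal (-1) k (x # replicate m 1)" and "0 < x" "x < 1" "1 \<le> m" "1 \<le> k"
  shows False
proof -
  obtain p where m: "m = Suc p" using \<open>1 \<le> m\<close> by (cases m) auto
  define K where "K = nat (k - 1)"
  have k: "k = int K + 1" using \<open>1 \<le> k\<close> by (simp add: K_def)
  define P where "P u = hsym (int K + 1) (u # replicate m 1)" for u
  have slope: "pair_slope k x 1 (replicate p 1) = 0"
    by (rule extremal_pair_slope[of "-1"]) (use assms m in auto)
  have "hsym (int K) (x # replicate (Suc m) 1) = hsym (int K) (1 # x # 1 # replicate p 1)"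
    by (rule hsym_cong_mset) (simp add: m)
  also have "\<dots> = hsym (int K - 1) (x # 1 # x # 1 # replicate p 1)"
    using pair_slope_zero(2)[OF slope] by (simp add: k)
  also have "\<dots> = hsym (int K - 1) (x # x # replicate (Suc m) 1)"
    by (rule hsym_cong_mset) (simp add: m)
  finally obtain u where u: "0 < u" "ln (P u) - real (Suc K) / 2 * ln (u\<^sup>2 + real m)
            < ln (P x) - real (Suc K) / 2 * ln (x\<^sup>2 + real m)"
    using critical_point_not_minimal[OF assms(2-4), of K] unfolding P_def by blast
  have q_pos: "0 < v\<^sup>2 + real m" for v :: real
    using \<open>1 \<le> m\<close> by (intro add_nonneg_pos) auto
  have P_pos: "0 < P v" if "0 < v" for v
    unfolding P_def using that by (intro hsym_pos) auto
  \<comment> \<open>Rescaling the better point \<open>(u, 1, \<dots>, 1)\<close> to the original sum of squares.\<close>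
  define c where "c = sqrt ((x\<^sup>2 + real m) / (u\<^sup>2 + real m))"
  have c: "0 < c" "c\<^sup>2 * (u\<^sup>2 + real m) = x\<^sup>2 + real m"
    using q_pos[of x] q_pos[of u] by (auto simp: c_def)
  have "competitor (x # replicate m 1) (map ((*) c) (u # replicate m 1))"
    using c \<open>0 < u\<close> by (simp add: competitor_def sum_list_replicate power_mult_distrib algebra_simps)
  then have "P x \<le> hsym k (map ((*) c) (u # replicate m 1))"
    using ext by (simp add: extremal_def P_def k)
  also have "\<dots> = c ^ Suc K * P u"
    unfolding hsym_scale by (simp add: k P_def nat_add_distrib)
  finally have "ln (P x) \<le> ln (c ^ Suc K * P u)"
    using P_pos \<open>0 < x\<close> c \<open>0 < u\<close> by (subst ln_le_cancel_iff) auto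
  also have "\<dots> = real (Suc K) * ln c + ln (P u)"
    using P_pos[OF \<open>0 < u\<close>] c by (subst ln_mult) (auto simp: ln_realpow simp del: power_Suc)
  also have "ln c = (ln (x\<^sup>2 + real m) - ln (u\<^sup>2 + real m)) / 2"
    unfolding c_def using q_pos[of x] q_pos[of u] by (simp add: ln_sqrt ln_div)
  finally show False using u(2) by (simp add: algebra_simps diff_divide_distrib)
qed

section \<open>Moments of sums of exponential variables\<close>

text \<open>Adding one variable expands the power by the binomial theorem; since \<open>\<E> X\<^sup>j = j!\<close>, the factorials
  cancel the binomial coefficients up to \<open>k!\<close>, and what is left is the recursion defining \<open>hsym\<close>.\<close>

lemma (in prob_space) moment_exponential_combination:
  assumes "distinct is" and indep: "indep_vars (\<lambda>_. borel) X (set is)"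
    and expo: "\<And>i. i \<in> set is \<Longrightarrow> distributed M lborel (X i) (\<lambda>x. ennreal (exponential_density 1 x))"
  shows "has_bochner_integral M (\<lambda>\<omega>. (\<Sum>i\<in>set is. a i * X i \<omega>) ^ k) (fact k * hsym (int k) (map a is))"
  using assms
proof (induction "is" arbitrary: k)
  case Nil
  show ?case
    by (cases "k = 0") (auto simp: power_0_left has_bochner_integral_iff prob_space)
next
  case (Cons i "is")
  let ?S = "\<lambda>\<omega>. \<Sum>j\<in>set is. a j * X j \<omega>"
  have rv: "X i \<in> borel_measurable M" using Cons.prems(2) by (auto simp: indep_vars_def)
  have "indep_vars (\<lambda>_. borel) X (set is)" by (rule indep_vars_subset[OF Cons.prems(2)]) auto
  then have S: "has_bochner_integral M (\<lambda>\<omega>. ?S \<omega> ^ k) (fact k * hsym (int k) (map a is))" for k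
    using Cons.prems by (intro Cons.IH) auto
  have X: "has_bochner_integral M (\<lambda>\<omega>. (a i * X i \<omega>) ^ j) (a i ^ j * fact j)" for j
    using has_bochner_integral_mult_right[OF has_bochner_integral_erlang_ith_moment[of 1 "X i" 0 j], of "a i ^ j"]
      Cons.prems(3)[of i] by (simp add: power_mult_distrib)
  have "indep_vars (\<lambda>_. borel) (\<lambda>j \<omega>. a j * X j \<omega>) (insert i (set is))"
    using indep_vars_compose2[OF Cons.prems(2), of "\<lambda>j x. a j * x" "\<lambda>_. borel"] by simp
  then have ind: "indep_var borel (\<lambda>\<omega>. a i * X i \<omega>) borel ?S"
    using Cons.prems(1) by (intro indep_vars_sum) auto
  have indep2: "indep_var borel (\<lambda>\<omega>. (a i * X i \<omega>) ^ j) borel (\<lambda>\<omega>. ?S \<omega> ^ l)" for j l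
    using indep_var_compose[OF ind, of "\<lambda>x. x ^ j" borel "\<lambda>x. x ^ l" borel] by (simp add: o_def)
  have prod: "has_bochner_integral M (\<lambda>\<omega>. (a i * X i \<omega>) ^ j * ?S \<omega> ^ l)
      (a i ^ j * fact j * (fact l * hsym (int l) (map a is)))" for j l
    using indep_var_lebesgue_integral[OF indep2, of j l] indep_var_integrable[OF indep2, of j l]
      X[of j] S[of l] by (simp add: has_bochner_integral_iff)
  have "has_bochner_integral M
      (\<lambda>\<omega>. \<Sum>j\<le>k. real (k choose j) * ((a i * X i \<omega>) ^ j * ?S \<omega> ^ (k - j)))
      (\<Sum>j\<le>k. real (k choose j) * (a i ^ j * fact j * (fact (k - j) * hsym (int (k - j)) (map a is))))"
    by (intro has_bochner_integral_sum has_bochner_integral_mult_right prod)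
  also have "(\<lambda>\<omega>. \<Sum>j\<le>k. real (k choose j) * ((a i * X i \<omega>) ^ j * ?S \<omega> ^ (k - j))) =
      (\<lambda>\<omega>. (\<Sum>j\<in>set (i # is). a j * X j \<omega>) ^ k)"
    using Cons.prems(1) by (simp add: binomial_ring mult.assoc)
  also have "(\<Sum>j\<le>k. real (k choose j) * (a i ^ j * fact j * (fact (k - j) * hsym (int (k - j)) (map a is)))) =
      (\<Sum>j\<le>k. fact k * (a i ^ j * hsym (int k - int j) (map a is)))"
  proof (intro sum.cong refl)
    fix j assume "j \<in> {..k}"
    then have "j \<le> k" by simp
    then have "real (k choose j) * fact j * fact (k - j) = fact k"
      by (simp add: binomial_fact)
    then show "real (k choose j) * (a i ^ j * fact j * (fact (k - j) * hsym (int (k - j)) (map a is))) =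
        fact k * (a i ^ j * hsym (int k - int j) (map a is))"
      using \<open>j \<le> k\<close> by (simp add: of_nat_diff algebra_simps)
  qed
  also have "\<dots> = fact k * hsym (int k) (map a (i # is))"
    by (simp add: hsym.simps(2) sum_distrib_left)
  finally show ?case .
qed

lemma prob_space_std_exponential: "prob_space std_exponential"
  unfolding std_exponential_def by (rule prob_space_exponential_density) simp

lemma sets_std_exponential [measurable_cong, simp]: "sets std_exponential = sets borel"
  by (simp add: std_exponential_def)

lemma AE_std_exponential_pos: "AE x in std_exponential. 0 < x"
proof -
  have "AE x in lborel. x \<noteq> (0::real)" by (rule AE_lborel_singleton)
  then have "AE x in lborel. 0 < ennreal (exponential_density 1 x) \<longrightarrow> 0 < (x::real)"
    by eventually_elim (auto simp: exponential_density_def)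
  then show ?thesis unfolding std_exponential_def by (subst AE_density) auto
qed

text \<open>The coordinates of the product space are independent standard exponentials.  Their sum is almost
  surely positive, where the real power agrees with the natural one.\<close>

lemma rho_eq:
  assumes "1 \<le> m"
  shows "rho m (real k) = fact k * hsym (int k) (replicate m (1 / sqrt (real m)))"
proof -
  let ?P = "PiM {1..m} (\<lambda>_. std_exponential)"
  interpret prob_space ?P by (intro prob_space_PiM prob_space_std_exponential)
  have meas: "(\<lambda>\<omega>. \<omega> i) \<in> measurable ?P std_exponential" if "i \<in> {1..m}" for i
    using that by (rule measurable_component_singleton)
  have comp: "distr ?P std_exponential (\<lambda>\<omega>. \<omega> i) = std_exponential" if "i \<in> {1..m}" for i
    using that by (intro distr_PiM_component prob_space_std_exponential)
  have comp': "distr ?P borel (\<lambda>\<omega>. \<omega> i) = std_exponential" if "i \<in> {1..m}" for i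
    using distr_cong[OF refl sets_std_exponential[symmetric] refl, of ?P "\<lambda>\<omega>. \<omega> i"] comp[OF that] by simp
  have rv: "(\<lambda>\<omega>. \<omega> i) \<in> borel_measurable ?P" if "i \<in> {1..m}" for i
    using meas[OF that] measurable_cong_sets[OF refl sets_std_exponential] by blast
  have "distr ?P (PiM {1..m} (\<lambda>_. borel)) (\<lambda>x. \<lambda>i\<in>{1..m}. x i) = distr ?P ?P (\<lambda>x. x)"
    by (intro distr_cong refl sets_PiM_cong) (auto simp: space_PiM PiE_restrict)
  also have "\<dots> = ?P" by (rule distr_id)
  also have "\<dots> = PiM {1..m} (\<lambda>i. distr ?P borel (\<lambda>\<omega>. \<omega> i))"
    by (intro PiM_cong refl comp'[symmetric])
  finally have "indep_vars (\<lambda>_. borel) (\<lambda>i \<omega>. \<omega> i) {1..m}"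
    using assms rv by (subst indep_vars_iff_distr_eq_PiM') auto
  moreover have "distributed ?P lborel (\<lambda>\<omega>. \<omega> i) (\<lambda>x. ennreal (exponential_density 1 x))"
    if "i \<in> {1..m}" for i
  proof -
    have "distr ?P lborel (\<lambda>\<omega>. \<omega> i) = std_exponential"
      using distr_cong[OF refl sets_lborel refl, of ?P "\<lambda>\<omega>. \<omega> i"] comp'[OF that] by simp
    then show ?thesis using rv[OF that] by (auto simp: distributed_def std_exponential_def)
  qed
  ultimately have "has_bochner_integral ?P (\<lambda>\<omega>. (\<Sum>i\<in>set [1..<Suc m]. (1 / sqrt (real m)) * \<omega> i) ^ k)
      (fact k * hsym (int k) (map (\<lambda>_. 1 / sqrt (real m)) [1..<Suc m]))"
    by (intro moment_exponential_combination) (auto simp: atLeastLessThanSuc_atLeastAtMost simp del: upt_Suc)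
  then have "(\<integral>\<omega>. ((\<Sum>i=1..m. \<omega> i) / sqrt (real m)) ^ k \<partial>?P) =
      fact k * hsym (int k) (replicate m (1 / sqrt (real m)))"
    by (simp add: has_bochner_integral_iff map_replicate_const atLeastLessThanSuc_atLeastAtMost
        sum_divide_distrib del: upt_Suc)
  moreover have "rho m (real k) = (\<integral>\<omega>. ((\<Sum>i=1..m. \<omega> i) / sqrt (real m)) ^ k \<partial>?P)"
    unfolding rho_def
  proof (intro integral_cong_AE)
    have "AE \<omega> in ?P. \<forall>i\<in>{1..m}. 0 < \<omega> i"
      by (intro AE_finite_allI AE_PiM_component prob_space_std_exponential AE_std_exponential_pos) auto
    then show "AE \<omega> in ?P. ((\<Sum>i=1..m. \<omega> i) / sqrt (real m)) powr real k
        = ((\<Sum>i=1..m. \<omega> i) / sqrt (real m)) ^ k"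
    proof eventually_elim
      case (elim \<omega>)
      then have "0 < (\<Sum>i=1..m. \<omega> i)" using assms by (intro sum_pos) auto
      then show ?case using assms by (simp add: powr_realpow)
    qed
    have "(\<lambda>\<omega>. \<Sum>i=1..m. \<omega> i) \<in> borel_measurable ?P"
      by (intro borel_measurable_sum rv)
    then show "(\<lambda>\<omega>. ((\<Sum>i=1..m. \<omega> i) / sqrt (real m)) powr real k) \<in> borel_measurable ?P"
      "(\<lambda>\<omega>. ((\<Sum>i=1..m. \<omega> i) / sqrt (real m)) ^ k) \<in> borel_measurable ?P"
      by measurable
  qed
  ultimately show ?thesis by simp
qed

section \<open>The shape of maximal and minimal points\<close>

lemma extremal_remove_zeros:
  assumes "extremal \<sigma> k (xs @ replicate z 0)"
  shows "extremal \<sigma> k xs"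
proof -
  have h: "hsym k (ys @ replicate z 0) = hsym k ys" for ys
    using hsym_filter_nonzero[of k ys] hsym_filter_nonzero[of k "ys @ replicate z 0"] by simp
  have "\<sigma> * hsym k ys \<le> \<sigma> * hsym k xs" if "competitor xs ys" for ys
  proof -
    have "competitor (xs @ replicate z 0) (ys @ replicate z 0)"
      using that by (auto simp: competitor_def)
    then show ?thesis using assms by (auto simp: extremal_def h)
  qed
  then show ?thesis using assms by (simp add: extremal_def)
qed

lemma extremal_scale:
  assumes "extremal \<sigma> k xs" "0 < c"
  shows "extremal \<sigma> k (map ((*) c) xs)"
proof -
  have "\<sigma> * hsym k ys \<le> \<sigma> * hsym k (map ((*) c) xs)" if comp: "competitor (map ((*) c) xs) ys" for ys
  proof -
    have ys: "ys = map ((*) c) (map (\<lambda>y. y / c) ys)" using \<open>0 < c\<close> by (simp add: o_def)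
    have sq: "(\<Sum>x\<leftarrow>map ((*) c) zs. x\<^sup>2) = c\<^sup>2 * (\<Sum>x\<leftarrow>zs. x\<^sup>2)" for zs
      by (simp add: o_def power_mult_distrib sum_list_const_mult)
    have "c\<^sup>2 * (\<Sum>x\<leftarrow>map (\<lambda>y. y / c) ys. x\<^sup>2) = c\<^sup>2 * (\<Sum>x\<leftarrow>xs. x\<^sup>2)"
      using comp unfolding sq[symmetric] ys[symmetric] by (simp add: competitor_def)
    then have "competitor xs (map (\<lambda>y. y / c) ys)"
      using comp \<open>0 < c\<close> by (auto simp: competitor_def)
    then have "c ^ nat k * (\<sigma> * hsym k (map (\<lambda>y. y / c) ys)) \<le> c ^ nat k * (\<sigma> * hsym k xs)"
      using assms by (intro mult_left_mono[OF _ zero_le_power]) (auto simp: extremal_def)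
    then show ?thesis by (subst ys) (simp only: hsym_scale mult.left_commute)
  qed
  then show ?thesis using assms by (auto simp: extremal_def)
qed

lemma mset_eq_two_distinct:
  assumes "a \<in> set xs" "b \<in> set xs" "a \<noteq> b"
  obtains ys where "mset xs = mset (a # b # ys)"
proof
  have "b \<in> set (remove1 a xs)" using assms by simp
  then have "mset (remove1 a xs) = mset (b # remove1 b (remove1 a xs))"
    by (metis insert_DiffM mset.simps(2) mset_remove1 set_mset_mset)
  then show "mset xs = mset (a # b # remove1 b (remove1 a xs))"
    using assms(1) by (metis insert_DiffM mset.simps(2) mset_remove1 set_mset_mset)
qed

text \<open>The hypothesis \<open>0 < \<sigma> * (a - b)\<close> says that \<open>a\<close> is the larger value of a maximum or the smaller
  value of a minimum; such a value cannot be repeated.\<close>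

lemma extremal_two_value_shape:
  assumes ext: "extremal \<sigma> k xs" and pos: "\<And>x. x \<in> set xs \<Longrightarrow> 0 < x"
    and ab: "a \<in> set xs" "b \<in> set xs" "0 < \<sigma> * (a - b)" and "1 \<le> k"
  shows "mset xs = mset (a # replicate (length xs - 1) b)"
proof -
  have "a \<noteq> b" "\<sigma> \<noteq> 0" using ab(3) by auto
  obtain ys where ys: "mset xs = mset (a # b # ys)"
    using mset_eq_two_distinct[OF ab(1,2) \<open>a \<noteq> b\<close>] .
  have len: "length xs = Suc (Suc (length ys))" using mset_eq_length[OF ys] by simp
  have set_xs: "set xs = insert a (insert b (set ys))" using mset_eq_setD[OF ys] by simp
  have "c = b" if "c \<in> set ys" for c
  proof (rule ccontr)
    assume "c \<noteq> b"
    define zs where "zs = remove1 c ys"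
    have zs: "mset xs = mset (a # b # c # zs)" using ys that by (simp add: zs_def)
    show False
    proof (cases "c = a")
      case True
      have "extremal \<sigma> k (a # a # b # zs)"
        by (rule extremal_cong_mset[OF ext]) (use zs True in simp)
      from extremal_double[OF this] have "\<sigma> * (a - b) \<le> 0"
        using pos ab \<open>a \<noteq> b\<close> \<open>\<sigma> \<noteq> 0\<close> \<open>1 \<le> k\<close> by blast
      then show False using ab(3) by simp
    next
      case False
      from extremal_two_values[OF extremal_cong_mset[OF ext zs]] show False
        using pos ab that set_xs \<open>a \<noteq> b\<close> \<open>c \<noteq> b\<close> False \<open>\<sigma> \<noteq> 0\<close> \<open>1 \<le> k\<close> by auto
    qed
  qed
  then have "ys = replicate (length ys) b" by (intro replicate_eqI) auto
  then show ?thesis unfolding ys len by (metis diff_Suc_1 replicate_Suc)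
qed

lemma maximal_shape:
  assumes ext: "extremal 1 k xs" and ne: "\<exists>x\<in>set xs. 0 < x" and "1 \<le> k"
  shows "\<exists>s t. 0 < t \<and> t \<le> s \<and> mset xs = mset (s # replicate (length xs - 1) t)"
proof -
  have nonneg: "\<And>x. x \<in> set xs \<Longrightarrow> 0 \<le> x" using ext by (simp add: extremal_def)
  have pos: "0 < x" if x: "x \<in> set xs" for x
  proof (rule ccontr)
    assume "\<not> 0 < x"
    with nonneg[OF x] have "x = 0" by simp
    obtain b where b: "b \<in> set xs" "0 < b" using ne by auto
    with x \<open>x = 0\<close> obtain ys where "mset xs = mset (0 # b # ys)"
      using mset_eq_two_distinct[of 0 xs b] by auto
    from maximal_all_positive[OF extremal_cong_mset[OF ext this]] show False using b \<open>1 \<le> k\<close> by simp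
  qed
  define s where "s = Max (set xs)"
  have s: "s \<in> set xs" "\<And>x. x \<in> set xs \<Longrightarrow> x \<le> s" using ne by (auto simp: s_def intro!: Max_in)
  show ?thesis
  proof (cases "\<exists>t\<in>set xs. t \<noteq> s")
    case True
    then obtain t where t: "t \<in> set xs" "t < s" using s by force
    have "mset xs = mset (s # replicate (length xs - 1) t)"
      by (rule extremal_two_value_shape[OF ext pos]) (use s t \<open>1 \<le> k\<close> in auto)
    with less_imp_le[OF t(2)] pos[OF t(1)] show ?thesis by (intro exI[of _ s] exI[of _ t] conjI)
  next
    case False
    then have "xs = replicate (length xs) s" by (intro replicate_eqI) auto
    moreover have "length xs = Suc (length xs - 1)" using s(1) by (cases xs) auto
    ultimately have "mset xs = mset (s # replicate (length xs - 1) s)" by (metis replicate_Suc)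
    with pos[OF s(1)] show ?thesis by (intro exI[of _ s] conjI order_refl)
  qed
qed

lemma minimal_shape:
  assumes ext: "extremal (-1) k xs" and ne: "\<exists>x\<in>set xs. 0 < x" and "1 \<le> k"
  shows "\<exists>c m. 0 < c \<and> 1 \<le> m \<and> m \<le> length xs \<and>
           mset xs = mset (replicate m c @ replicate (length xs - m) 0)"
proof -
  have nonneg: "\<And>x. x \<in> set xs \<Longrightarrow> 0 \<le> x" using ext by (simp add: extremal_def)
  define ys where "ys = filter (\<lambda>x. x \<noteq> 0) xs"
  have len: "length xs = length ys + length (filter (\<lambda>x. \<not> x \<noteq> 0) xs)"
    unfolding ys_def by (rule sum_length_filter_compl[symmetric])
  have "filter (\<lambda>x. \<not> x \<noteq> 0) xs = replicate (length (filter (\<lambda>x. \<not> x \<noteq> 0) xs)) 0"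
    by (intro replicate_eqI) auto
  then have zeros: "filter (\<lambda>x. \<not> x \<noteq> 0) xs = replicate (length xs - length ys) 0"
    using len by simp
  have xs: "mset xs = mset (ys @ replicate (length xs - length ys) 0)"
  proof -
    have "mset xs = mset ys + mset (filter (\<lambda>x. \<not> x \<noteq> 0) xs)"
      unfolding ys_def mset_filter by (rule multiset_partition)
    then show ?thesis unfolding zeros by (simp only: mset_append)
  qed
  have ext': "extremal (-1) k ys"
    by (rule extremal_remove_zeros[OF extremal_cong_mset[OF ext xs]])
  have pos: "0 < x" if "x \<in> set ys" for x
    using that nonneg[of x] by (auto simp: ys_def)
  have "ys \<noteq> []" using ne by (fastforce simp: ys_def filter_empty_conv)
  define c where "c = Max (set ys)"
  have c: "c \<in> set ys" "\<And>x. x \<in> set ys \<Longrightarrow> x \<le> c"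
    using \<open>ys \<noteq> []\<close> by (auto simp: c_def intro!: Max_in)
  have "x = c" if x: "x \<in> set ys" for x
  proof (rule ccontr)
    assume "x \<noteq> c"
    with c x have "x < c" by force
    have shape: "mset ys = mset (x # replicate (length ys - 1) c)"
      by (rule extremal_two_value_shape[OF ext' pos]) (use c x \<open>x < c\<close> \<open>1 \<le> k\<close> in auto)
    have m: "1 \<le> length ys - 1"
    proof (rule ccontr)
      assume "\<not> ?thesis"
      then have "length ys - 1 = 0" by simp
      then have "set ys = {x}" using mset_eq_setD[OF shape] by simp
      then show False using c(1) \<open>x < c\<close> by simp
    qed
    have "0 < c" by (rule pos[OF c(1)])
    have "extremal (-1) k (map ((*) (1 / c)) (x # replicate (length ys - 1) c))"
      by (rule extremal_scale[OF extremal_cong_mset[OF ext' shape]]) (use \<open>0 < c\<close> in simp)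
    then have "extremal (-1) k (x / c # replicate (length ys - 1) 1)"
      using \<open>0 < c\<close> by simp
    then show False
      by (rule minimal_not_mixed_unit) (use pos[OF x] \<open>0 < c\<close> \<open>x < c\<close> m \<open>1 \<le> k\<close> in auto)
  qed
  then have "ys = replicate (length ys) c" by (intro replicate_eqI) auto
  then have "mset xs = mset (replicate (length ys) c @ replicate (length xs - length ys) 0)"
    using xs by simp
  moreover have "1 \<le> length ys" "length ys \<le> length xs" using \<open>ys \<noteq> []\<close> len by (auto simp: Suc_le_eq)
  ultimately show ?thesis using pos[OF c(1)] by blast
qed

lemma sum_list_upt: "(\<Sum>i\<leftarrow>[1..<Suc n]. f i) = (\<Sum>i=1..n. f i)" for f :: "nat \<Rightarrow> real"
  by (simp only: interv_sum_list_conv_sum_set_nat set_upt atLeastLessThanSuc_atLeastAtMost)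

text \<open>Coordinates outside \<open>{1..n}\<close> may be set to zero, which leaves a compact set in the product
  topology.\<close>

lemma extremal_exists:
  assumes "1 \<le> n"
  shows "\<exists>a\<in>nonneg_unit_vectors n. \<forall>b\<in>nonneg_unit_vectors n.
           \<sigma> * hsym k (map b [1..<Suc n]) \<le> \<sigma> * hsym k (map a [1..<Suc n])"
proof -
  define f where "f a = \<sigma> * hsym k (map a [1..<Suc n])" for a
  define C where "C = (\<Pi>\<^sub>E i\<in>UNIV. if i \<in> {1..n} then {0..1::real} else {0})"
  define S where "S = C \<inter> {a. (\<Sum>i=1..n. (a i)\<^sup>2) = 1}"
  have "compactin (product_topology (\<lambda>i. euclidean) UNIV) C"
    unfolding C_def compactin_PiE by auto
  then have "compact C" by (simp add: euclidean_product_topology)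
  moreover have coord: "continuous_on A (\<lambda>a::nat \<Rightarrow> real. a i)" for i A
    by (rule continuous_on_subset[OF continuous_on_product_coordinates]) simp
  then have "closed {a. (\<Sum>i=1..n. (a i :: real)\<^sup>2) = 1}"
    by (intro closed_Collect_eq continuous_intros)
  ultimately have "compact S" unfolding S_def by (rule compact_Int_closed)
  have "(\<Sum>i=1..n. (if i = 1 then 1 else 0 :: real)\<^sup>2) = (\<Sum>i=1..n. if i = 1 then 1 else 0)"
    by (intro sum.cong) auto
  also have "\<dots> = 1" using assms by simp
  finally have "(\<lambda>i. if i = 1 then 1 else 0) \<in> S"
    using assms by (auto simp: S_def C_def PiE_def extensional_def)
  then have "S \<noteq> {}" by blast
  have "continuous_on S f"
    unfolding f_def by (intro continuous_intros continuous_on_hsym coord)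
  from continuous_attains_sup[OF \<open>compact S\<close> \<open>S \<noteq> {}\<close> this]
  obtain a where a: "a \<in> S" "\<And>b. b \<in> S \<Longrightarrow> f b \<le> f a" by blast
  have "a i \<ge> 0" if "i \<in> {1..n}" for i
    using a(1) that by (auto simp: S_def C_def PiE_def Pi_def split: if_splits)
  then have "a \<in> nonneg_unit_vectors n" using a(1) by (auto simp: nonneg_unit_vectors_def S_def)
  moreover have "f b \<le> f a" if b: "b \<in> nonneg_unit_vectors n" for b
  proof -
    define b' where "b' i = (if i \<in> {1..n} then b i else 0)" for i
    have "b i \<le> 1" if "i \<in> {1..n}" for i
    proof -
      have "(b i)\<^sup>2 \<le> (\<Sum>i=1..n. (b i)\<^sup>2)" using that by (intro member_le_sum) auto
      then show ?thesis using b by (simp add: nonneg_unit_vectors_def abs_square_le_1)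
    qed
    then have "b' \<in> S" using b
      by (auto simp: b'_def S_def C_def nonneg_unit_vectors_def)
    moreover have "map b' [1..<Suc n] = map b [1..<Suc n]" by (simp add: b'_def del: upt_Suc)
    ultimately show ?thesis using a(2) by (metis f_def)
  qed
  ultimately show ?thesis unfolding f_def by blast
qed

text \<open>Every list of length \<open>n\<close> is the list of values of some function on \<open>{1..n}\<close>.\<close>

lemma extremal_map:
  assumes a: "a \<in> nonneg_unit_vectors n"
    and max: "\<And>b. b \<in> nonneg_unit_vectors n \<Longrightarrow>
           \<sigma> * hsym k (map b [1..<Suc n]) \<le> \<sigma> * hsym k (map a [1..<Suc n])"
  shows "extremal \<sigma> k (map a [1..<Suc n])"
  unfolding extremal_def
proof (intro conjI allI impI)
  show "\<forall>x\<in>set (map a [1..<Suc n]). 0 \<le> x"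
    using a by (auto simp: nonneg_unit_vectors_def simp del: upt_Suc)
  fix ys assume comp: "competitor (map a [1..<Suc n]) ys"
  define b where "b i = ys ! (i - 1)" for i
  have len: "length ys = n" using comp by (simp add: competitor_def)
  have ys: "map b [1..<Suc n] = ys"
    by (rule nth_equalityI) (simp_all add: len b_def del: upt_Suc)
  have "(\<Sum>i=1..n. (b i)\<^sup>2) = (\<Sum>y\<leftarrow>ys. y\<^sup>2)"
    unfolding sum_list_upt[symmetric] by (subst ys[symmetric]) (simp add: o_def del: upt_Suc)
  also have "\<dots> = (\<Sum>i=1..n. (a i)\<^sup>2)"
    using comp unfolding sum_list_upt[symmetric] by (simp add: competitor_def o_def del: upt_Suc)
  finally have "b \<in> nonneg_unit_vectors n"
    using a comp len by (auto simp: nonneg_unit_vectors_def competitor_def b_def)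
  from max[OF this] show "\<sigma> * hsym k ys \<le> \<sigma> * hsym k (map a [1..<Suc n])"
    unfolding ys .
qed

lemma hsym_replicate:
  "hsym (int i) (replicate (Suc p) x) = x ^ i * real ((i + p) choose p)"
  using hsym_scale[of "int i" x "replicate (Suc p) 1"] hsym_ones[of i p] by simp

text \<open>With \<open>m = n - 1\<close>, the values of the gamma function turn the first summands of the coefficients
  into \<open>- k! m! (k - j) (j + m - 1 choose m - 1)\<close> and the second ones into
  \<open>k! m! (j + m + 1 choose m)\<close>; these are the coefficients of the two polynomials on the right.\<close>

lemma g_eq:
  assumes "2 \<le> n" "1 \<le> k"
  shows "g n k x = fact k * fact (n - 1) *
     (hsym (int k - 1) (1 # replicate n x) - x * hsym (int k - 1) (1 # 1 # replicate (n - 1) x))"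
proof -
  obtain p where n: "n = Suc (Suc p)" using assms(1) by (metis Suc_le_D numeral_2_eq_2 Suc_le_mono)
  obtain K where k: "k = Suc K" using assms(2) by (cases k) auto
  let ?c = "fact k * fact (Suc p) :: real"
  have rev: "(\<Sum>j\<le>K. f (K - j)) = (\<Sum>j\<le>K. f j)" for f :: "nat \<Rightarrow> real"
    by (rule sum.reindex_bij_witness[of _ "\<lambda>j. K - j" "\<lambda>j. K - j"]) auto
  have h1: "hsym (int K) (1 # replicate n x) = (\<Sum>i\<le>K. x ^ i * real (i + Suc p choose Suc p))"
  proof -
    have "hsym (int K) (1 # replicate n x) = (\<Sum>j\<le>K. hsym (int (K - j)) (replicate n x))"
      by (subst hsym_Cons_sum[OF order_refl]) (auto intro!: sum.cong simp: of_nat_diff)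
    also have "\<dots> = (\<Sum>i\<le>K. hsym (int i) (replicate n x))" by (rule rev)
    finally show ?thesis unfolding n hsym_replicate .
  qed
  have h2: "hsym (int K) (1 # 1 # replicate (n - 1) x) =
      (\<Sum>i\<le>K. (real k - real i) * (x ^ i * real (i + p choose p)))"
  proof -
    have "hsym (int K) (1 # 1 # replicate (n - 1) x) =
        (\<Sum>j\<le>K. (real k - real (K - j)) * hsym (int (K - j)) (replicate (n - 1) x))"
      by (subst hsym_double_sum[OF order_refl]) (auto intro!: sum.cong simp: of_nat_diff k)
    also have "\<dots> = (\<Sum>i\<le>K. (real k - real i) * hsym (int i) (replicate (n - 1) x))"
      by (rule rev[of "\<lambda>i. (real k - real i) * hsym (int i) (replicate (n - 1) x)"])
    finally show ?thesis by (simp add: n hsym_replicate del: replicate_Suc)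
  qed
  have Gam: "Gamma (real (Suc i)) = fact i" for i
    using Gamma_fact[of i] by (simp add: add.commute)
  have fact_add: "fact (a + b) = real (a + b choose b) * fact b * fact a" for a b
    by (simp add: binomial_fact)
  have first: "real (k choose 1) * Gamma (real n) * Gamma (real k) = ?c"
    by (simp only: n k Gam) (simp add: algebra_simps)
  have last: "real (k choose (k - 1)) * Gamma (real k + real n - 2) * Gamma 2 * (real n - 1) =
      ?c * real (K + p choose p)"
  proof -
    have "Gamma (real k + real n - 2) = fact (K + p)"
      using Gam[of "K + p"] by (simp add: n k add_ac)
    moreover have "Gamma (2::real) = 1" using Gam[of 1] by simp
    moreover have "real (k choose (k - 1)) = real k" by (simp add: k)
    moreover have "fact (K + p) = real (K + p choose p) * fact p * fact K"
      by (rule fact_add)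
    ultimately show ?thesis by (simp add: n k algebra_simps)
  qed
  have A: "real (k choose j) * Gamma (real j + real n - 1) * Gamma (real k - real j + 1)
             * (real n - 1) * (real j - real k) = - ?c * (real k - real j) * real (j + p choose p)"
    if "j \<le> k" for j
  proof -
    have "Gamma (real j + real n - 1) = fact (j + p)"
      using Gam[of "j + p"] by (simp add: n add_ac)
    moreover have "Gamma (real k - real j + 1) = fact (k - j)"
      using Gam[of "k - j"] that by (simp add: of_nat_diff add_ac)
    moreover have "fact (j + p) = real (j + p choose p) * fact p * fact j"
      by (rule fact_add)
    moreover have "fact k = real (k choose j) * fact j * fact (k - j)"
      using that by (simp add: binomial_fact)
    ultimately show ?thesis by (simp add: n algebra_simps)
  qed
  have B: "(real j + 2) * real (k choose (j + 2)) * Gamma (real j + real n + 1)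
             * Gamma (real k - real j - 1) = ?c * real (Suc j + Suc p choose Suc p)"
    if "j < K" for j
  proof -
    have "Gamma (real j + real n + 1) = fact (Suc j + Suc p)"
      using Gam[of "Suc j + Suc p"] by (simp add: n add_ac)
    moreover have "Gamma (real k - real j - 1) = fact (k - (j + 2))"
      using Gam[of "k - (j + 2)"] that by (simp add: of_nat_diff k)
    moreover have "fact (Suc j + Suc p) = real (Suc j + Suc p choose Suc p) * fact (Suc p) * fact (Suc j)"
      by (rule fact_add)
    moreover have "fact k = real (k choose (j + 2)) * ((real j + 2) * fact (Suc j)) * fact (k - (j + 2))"
    proof -
      have "k - (j + 2) + (j + 2) = k" using that by (simp add: k)
      then have "fact k = real (k choose (j + 2)) * fact (Suc (Suc j)) * fact (k - (j + 2))"
        using fact_add[of "k - (j + 2)" "j + 2"] by (simp only: add_2_eq_Suc')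
      moreover have "fact (Suc (Suc j)) = (real j + 2) * fact (Suc j)"
        by (subst fact_Suc) (simp add: add_ac del: fact_Suc)
      ultimately show ?thesis by simp
    qed
    ultimately show ?thesis by (simp only:) (simp only: mult_ac)
  qed
  let ?a = "\<lambda>i. x ^ i * real (i + Suc p choose Suc p)"
  let ?b = "\<lambda>i. (real k - real i) * (x ^ i * real (i + p choose p))"
  have "g n k x = ?c + (\<Sum>j<k - 1. x ^ (j + 1) * (- ?c * (real k - real j) * real (j + p choose p)
      + ?c * real (Suc j + Suc p choose Suc p))) - ?c * real (K + p choose p) * x ^ k"
    unfolding g_def first last
  proof (intro arg_cong2[where f = "(-)"] arg_cong2[where f = "(+)"] sum.cong refl)
    fix j assume "j \<in> {..<k - 1}"
    then have "j \<le> k" "j < K" by (auto simp: k)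
    from A[OF this(1)] B[OF this(2)]
    show "x ^ (j + 1) * (real (k choose j) * Gamma (real j + real n - 1) * Gamma (real k - real j + 1)
             * (real n - 1) * (real j - real k)
           + (real j + 2) * real (k choose (j + 2)) * Gamma (real j + real n + 1)
             * Gamma (real k - real j - 1)) =
        x ^ (j + 1) * (- ?c * (real k - real j) * real (j + p choose p)
      + ?c * real (Suc j + Suc p choose Suc p))"
      by (simp only:)
  qed
  also have "\<dots> = ?c * (1 + (\<Sum>j<K. ?a (Suc j)) - (\<Sum>j<K. x * ?b j) - x * ?b K)"
  proof -
    have "(\<Sum>j<k - 1. x ^ (j + 1) * (- ?c * (real k - real j) * real (j + p choose p)
        + ?c * real (Suc j + Suc p choose Suc p))) =
        (\<Sum>j<K. ?c * ?a (Suc j) - ?c * (x * ?b j))"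
      by (intro sum.cong) (simp_all add: k algebra_simps del: fact_Suc binomial_Suc_Suc of_nat_Suc)
    moreover have "?c * real (K + p choose p) * x ^ k = ?c * (x * ?b K)"
      by (simp add: k algebra_simps)
    ultimately show ?thesis
      by (simp only: sum_subtractf sum_distrib_left[symmetric] right_diff_distrib distrib_left mult_1_right)
  qed
  also have "1 + (\<Sum>j<K. ?a (Suc j)) = (\<Sum>j\<le>K. ?a j)"
    by (simp add: sum.atMost_shift)
  also have "(\<Sum>j\<le>K. ?a j) - (\<Sum>j<K. x * ?b j) - x * ?b K = (\<Sum>j\<le>K. ?a j) - x * (\<Sum>j\<le>K. ?b j)"
    by (simp add: sum_distrib_left lessThan_Suc_atMost[symmetric] algebra_simps)
  finally show ?thesis using h1 h2 by (simp add: k n)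
qed

theorem theorem4p5:
  fixes M :: "'a measure" and X :: "nat \<Rightarrow> 'a \<Rightarrow> real" and n k :: nat
  assumes "prob_space M"
    and "n \<ge> 1"
    and "prob_space.indep_vars M (\<lambda>_. borel) X {1..n}"
    and "\<And>i. i \<in> {1..n} \<Longrightarrow> distributed M lborel (X i) (\<lambda>x. ennreal (exponential_density 1 x))"
  shows "(\<forall>a\<in>nonneg_unit_vectors n.
            (\<integral>\<omega>. (\<Sum>i=1..n. a i * X i \<omega>) ^ k \<partial>M) \<ge> Min ((\<lambda>m. rho m (real k)) ` {1..n}))
       \<and> (\<exists>s t :: real. 0 < t \<and> t \<le> s
            \<and> (\<lambda>i. if i = 1 then s else t) \<in> nonneg_unit_vectors n
            \<and> (\<forall>a\<in>nonneg_unit_vectors n.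
                  (\<integral>\<omega>. (\<Sum>i=1..n. a i * X i \<omega>) ^ k \<partial>M)
                    \<le> (\<integral>\<omega>. (\<Sum>i=1..n. (if i = 1 then s else t) * X i \<omega>) ^ k \<partial>M))
            \<and> (n \<ge> 2 \<and> k \<ge> 1 \<longrightarrow> g n k (t / s) = 0))"
proof -
  interpret prob_space M by fact
  have moment: "(\<integral>\<omega>. (\<Sum>i=1..n. a i * X i \<omega>) ^ k \<partial>M) = fact k * hsym (int k) (map a [1..<Suc n])" for a
    using moment_exponential_combination[of "[1..<Suc n]" X a k] assms(3,4)
    by (simp add: has_bochner_integral_iff atLeastLessThanSuc_atLeastAtMost del: upt_Suc)
  have positive_entry: "\<exists>x\<in>set (map a [1..<Suc n]). 0 < x" if a: "a \<in> nonneg_unit_vectors n" for a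
  proof (rule ccontr)
    assume "\<not> ?thesis"
    then have "a i = 0" if "i \<in> {1..n}" for i
      using that a by (force simp: nonneg_unit_vectors_def simp del: upt_Suc)
    then show False using a by (simp add: nonneg_unit_vectors_def)
  qed
  have lower: "Min ((\<lambda>m. rho m (real k)) ` {1..n}) \<le> (\<integral>\<omega>. (\<Sum>i=1..n. b i * X i \<omega>) ^ k \<partial>M)"
    if b: "b \<in> nonneg_unit_vectors n" for b
  proof (cases "k = 0")
    case True
    have "Min ((\<lambda>m. rho m (real k)) ` {1..n}) \<le> rho 1 (real k)"
      using \<open>n \<ge> 1\<close> by (intro Min_le) auto
    also have "\<dots> = 1" unfolding rho_eq[OF order_refl] using True by simp
    finally show ?thesis unfolding moment using True by simp
  next
    case False
    obtain a where a: "a \<in> nonneg_unit_vectors n"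
      "\<And>b. b \<in> nonneg_unit_vectors n \<Longrightarrow> hsym (int k) (map a [1..<Suc n]) \<le> hsym (int k) (map b [1..<Suc n])"
      using extremal_exists[OF \<open>n \<ge> 1\<close>, of "-1" "int k"] by (auto simp del: upt_Suc)
    have ext: "extremal (-1) (int k) (map a [1..<Suc n])"
      by (rule extremal_map[OF a(1)]) (use a(2) in simp)
    from minimal_shape[OF ext positive_entry[OF a(1)]] False
    obtain c m where c: "0 < c" "1 \<le> m" "m \<le> n"
      "mset (map a [1..<Suc n]) = mset (replicate m c @ replicate (n - m) 0)"
      by (auto simp del: upt_Suc)
    have "(\<Sum>x\<leftarrow>map a [1..<Suc n]. x\<^sup>2) = (\<Sum>x\<leftarrow>replicate m c @ replicate (n - m) 0. x\<^sup>2)"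
      using c(4) by (metis mset_map sum_mset_sum_list)
    also have "\<dots> = real m * c\<^sup>2" by (simp add: sum_list_replicate)
    finally have "real m * c\<^sup>2 = (\<Sum>i=1..n. (a i)\<^sup>2)"
      unfolding sum_list_upt[symmetric] by (simp add: o_def del: upt_Suc)
    also have "\<dots> = 1" using a(1) by (simp add: nonneg_unit_vectors_def)
    finally have "sqrt (real m) * c = 1"
      using c(1) by (metis real_sqrt_mult real_sqrt_one real_sqrt_unique less_imp_le)
    then have c_eq: "c = 1 / sqrt (real m)" using c(2) by (simp add: field_simps)
    have "Min ((\<lambda>m. rho m (real k)) ` {1..n}) \<le> rho m (real k)"
      using c by (intro Min_le) auto
    also have "\<dots> = fact k * hsym (int k) (replicate m c @ replicate (n - m) 0)"
      unfolding rho_eq[OF c(2)] c_eq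
      using hsym_filter_nonzero[of "int k" "replicate m c @ replicate (n - m) 0"] c c_eq by simp
    also have "\<dots> = fact k * hsym (int k) (map a [1..<Suc n])"
      using hsym_cong_mset[OF c(4)] by simp
    also have "\<dots> \<le> fact k * hsym (int k) (map b [1..<Suc n])"
      using a(2)[OF b] by simp
    finally show ?thesis unfolding moment .
  qed
  define v :: "real \<Rightarrow> real \<Rightarrow> nat \<Rightarrow> real" where "v s t = (\<lambda>i. if i = 1 then s else t)" for s t
  have map_v: "map (v s t) [1..<Suc n] = s # replicate (n - 1) t" for s t
    using \<open>n \<ge> 1\<close> by (intro nth_equalityI) (auto simp: v_def nth_Cons' simp del: upt_Suc)
  have upper: "\<exists>s t. 0 < t \<and> t \<le> s \<and> v s t \<in> nonneg_unit_vectors n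
      \<and> (\<forall>b\<in>nonneg_unit_vectors n.
          hsym (int k) (map b [1..<Suc n]) \<le> hsym (int k) (map (v s t) [1..<Suc n]))
      \<and> (n \<ge> 2 \<and> k \<ge> 1 \<longrightarrow> g n k (t / s) = 0)"
  proof (cases "k = 0")
    case True
    have "v (1 / sqrt (real n)) (1 / sqrt (real n)) \<in> nonneg_unit_vectors n"
      using \<open>n \<ge> 1\<close> by (simp add: v_def nonneg_unit_vectors_def power_divide)
    then show ?thesis using True \<open>n \<ge> 1\<close>
      by (intro exI[of _ "1 / sqrt (real n)"]) simp
  next
    case False
    obtain a where a: "a \<in> nonneg_unit_vectors n"
      "\<And>b. b \<in> nonneg_unit_vectors n \<Longrightarrow> hsym (int k) (map b [1..<Suc n]) \<le> hsym (int k) (map a [1..<Suc n])"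
      using extremal_exists[OF \<open>n \<ge> 1\<close>, of 1 "int k"] by (auto simp del: upt_Suc)
    have ext: "extremal 1 (int k) (map a [1..<Suc n])"
      by (rule extremal_map[OF a(1)]) (use a(2) in simp)
    from maximal_shape[OF ext positive_entry[OF a(1)]] False
    obtain s t where st: "0 < t" "t \<le> s" "mset (map a [1..<Suc n]) = mset (s # replicate (n - 1) t)"
      by (auto simp del: upt_Suc)
    have ext': "extremal 1 (int k) (s # replicate (n - 1) t)"
      by (rule extremal_cong_mset[OF ext st(3)])
    have "(\<Sum>i=1..n. (v s t i)\<^sup>2) = (\<Sum>x\<leftarrow>map (v s t) [1..<Suc n]. x\<^sup>2)"
      unfolding sum_list_upt[symmetric] by (simp add: o_def del: upt_Suc)
    also have "\<dots> = (\<Sum>x\<leftarrow>map a [1..<Suc n]. x\<^sup>2)"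
      unfolding map_v using st(3) by (metis mset_map sum_mset_sum_list)
    also have "\<dots> = (\<Sum>i=1..n. (a i)\<^sup>2)"
      unfolding sum_list_upt[symmetric] by (simp add: o_def del: upt_Suc)
    also have "\<dots> = 1" using a(1) by (simp add: nonneg_unit_vectors_def)
    finally have "v s t \<in> nonneg_unit_vectors n"
      using st by (simp add: nonneg_unit_vectors_def v_def)
    moreover have "hsym (int k) (map b [1..<Suc n]) \<le> hsym (int k) (map (v s t) [1..<Suc n])"
      if "b \<in> nonneg_unit_vectors n" for b
      using a(2)[OF that] hsym_cong_mset[OF st(3)] unfolding map_v by simp
    moreover have "g n k (t / s) = 0" if nk: "n \<ge> 2" "k \<ge> 1"
    proof -
      define x where "x = t / s"
      have "s > 0" using st by simp
      obtain p where n: "n = Suc (Suc p)" using nk(1) by (metis Suc_le_D numeral_2_eq_2 Suc_le_mono)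
      have "hsym (int k - 1) (1 # replicate n x) = x * hsym (int k - 1) (1 # 1 # replicate (n - 1) x)"
      proof (cases "t = s")
        case True
        then show ?thesis using \<open>s > 0\<close> by (simp add: x_def n)
      next
        case False
        have "extremal 1 (int k) (map ((*) (1 / s)) (s # replicate (n - 1) t))"
          by (rule extremal_scale[OF ext']) (use \<open>s > 0\<close> in simp)
        then have "extremal 1 (int k) (1 # x # replicate p x)"
          using \<open>s > 0\<close> by (simp add: x_def n)
        then have slope: "pair_slope (int k) 1 x (replicate p x) = 0"
          by (rule extremal_pair_slope) (use \<open>s > 0\<close> st False in \<open>auto simp: x_def\<close>)
        have "hsym (int k - 1) (1 # replicate n x) = hsym (int k - 1) (x # 1 # x # replicate p x)"
          by (rule hsym_cong_mset) (simp add: n)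
        also have "\<dots> = x * hsym (int k - 1) (1 # 1 # x # replicate p x)"
          using pair_slope_zero[OF slope] by simp
        finally show ?thesis by (simp add: n)
      qed
      then show ?thesis unfolding g_eq[OF nk] x_def by simp
    qed
    ultimately show ?thesis using st by blast
  qed
  then obtain s t where st: "0 < t" "t \<le> s" "v s t \<in> nonneg_unit_vectors n"
    "\<And>b. b \<in> nonneg_unit_vectors n \<Longrightarrow>
          hsym (int k) (map b [1..<Suc n]) \<le> hsym (int k) (map (v s t) [1..<Suc n])"
    "n \<ge> 2 \<and> k \<ge> 1 \<longrightarrow> g n k (t / s) = 0"
    by blast
  have "(\<integral>\<omega>. (\<Sum>i=1..n. b i * X i \<omega>) ^ k \<partial>M) \<le> (\<integral>\<omega>. (\<Sum>i=1..n. v s t i * X i \<omega>) ^ k \<partial>M)"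
    if "b \<in> nonneg_unit_vectors n" for b
    unfolding moment using st(4)[OF that] by (intro mult_left_mono) auto
  with st lower show ?thesis unfolding v_def by blast
qed

end
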